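(* Let $n>k$ be positive integers, let $\Sigma$ be a topological space, and let $\mathcal{D}$ be a space of admissible dynamical systems of $n$ particles in $\Sigma$ with fixed initial and terminal states. Let $\mathcal{P}$ be a $k$-correct property for $\mathcal{D}$. Let $D_{0},D_{1}\in\mathcal{D}$ be two equivalent dynamical systems, each of which is pleasant and stable with respect to $\mathcal{P}$. Then $c(D_{0})=c(D_{1})$ as elements of the group $G_{n}^{k}$.
   Context: **Dynamical systems.** $\Sigma$ is a topological space and $n>k$ are positive integers. The space of continuous maps $[0,1]\to\Sigma^{n}$ carries the natural topology induced by the topology of $\Sigma^n$. A space of admissible dynamical systems $\mathcal{D}$ is a closed subset of this space; here it consists of maps with a fixed initial state $D(0)$ and a fixed terminal state $D(1)$. An element $D\in\mathcal{D}$ is called a dynamical system; its state at time $t$ is the ordered $n$-tuple of particles $D(t)\in\Sigma^{n}$, and particles are indexed by $1,\dots,n$. A multiindex is an unordered $k$-tuple of pairwise distinct elements of $\{1,\dots,n\}$. **$k$-good property.** A property $\mathcal{P}$, which for each state may or may not hold for each subset of the set of $n$ particles, is $k$-good if (at every state): (1) if it holds for a set of particles, it holds for every subset of it; (2) it holds for every set of $k-1$ particles; (3) for pairwise distinct indices $i_1,\dots,i_{k+1}$, if $\mathcal{P}$ holds for the particles $i_1,\dots,i_k$ and for the particles $i_2,\dots,i_{k+1}$, then it holds for the set of all $k+1$ particles $i_1,\dots,i_{k+1}$. **Critical moments, pleasantness, types.** A moment $t\in[0,1]$ is critical for $D$ if at the state $D(t)$ some set of $k$ particles has property $\mathcal{P}$.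 $D$ is pleasant if its set of critical moments is finite and for each critical moment there is exactly one $k$-element index set for which $\mathcal{P}$ holds (hence $\mathcal{P}$ holds for no larger set); this set is the multiindex of the critical moment. The type $\tau(D)$ of a pleasant $D$ is the list of multiindices $m^{1},\dots,m^{N}$ of its critical moments, written in order of increasing $t$. For a dynamical system $D$ and a multiindex $m$, the $m$-type $\tau_m(D)$ is the ordered set $t_1<t_2<\dots$ of those $t$ at which the set of particles with indices in $m$ has property $\mathcal{P}$; when the number $l$ of these values is fixed, $\tau_m(D)$ is regarded as a point of $\mathbb{R}^{l}$. **Stability.** $D$ is stable (with respect to $\mathcal{P}$) if there is a neighbourhood $U(D)$ of $D$ in $\mathcal{D}$ such that every dynamical system $D'\in U(D)$ is pleasant and, for each multiindex $m$, the number $l$ of critical values corresponding to $m$ is constant on $U(D)$ and $\tau_m:U(D)\to\mathbb{R}^{l}$ is a continuous map. **Deformations.** A deformation is a continuous path $s:[0,1]\to\mathcal{D}$ such that $s(0)$ and $s(1)$ are pleasant and stable. Two dynamical systems $D_0,D_1$ are equivalent if there is a deformation $s$ with $s(0)=D_0$, $s(1)=D_1$. A deformation $s$ is admissible if: 1. the set of $u$ for which $s(u)$ is not pleasant or not stable is finite, and for those $u$ for which $s(u)$ is not pleasant, $s(u)$ is stable; 2. inside the intervals of stability the $m$-types are continuous in $u$ for each multiindex $m$; 3. for each $u=u_0$ such that $s(u_0)$ is not pleasant, exactly one of the following occurs: (a) there is exactly one $t=t_0$ and exactly one $(k+1)$-tuple of indices $m=\{m_1,\dots,m_{k+1}\}$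 for which $\mathcal{P}$ holds at $t_0$ (hence $\mathcal{P}$ does not hold for larger sets); moreover, putting $\tilde m_j=m\setminus\{m_j\}$ for $j=1,\dots,k+1$ and letting $\zeta_j(u)$ be the coordinate of $\tau_{\tilde m_j}(s(u))$ that corresponds to the value $t=t_0$ at $u=u_0$, all functions $\zeta_j(u)$ are smooth and all derivatives $\frac{\partial\zeta_j}{\partial u}$ at $u_0$ are pairwise distinct; (b) there is exactly one $t=t_0$ and exactly two multiindices $m,m'$ (each of $k$ indices) for which $\mathcal{P}$ holds at $t_0$, and $\mathrm{Card}(m\cap m')<k-1$; 4. for each $u$ such that $s(u)$ is not stable there are a value $t=t_0$ which is not critical for $s(u)$ and a multiindex $\mu$ such that for some small $\varepsilon>0$ all $s(u')$ with $u'\in(u-\varepsilon,u)\cup(u,u+\varepsilon)$ are stable and, for $0<\delta<\varepsilon$, the type of $s(u+\delta)$ (as a list of multiindices) differs from the type of $s(u-\delta)$ by the addition or removal of two identical multiindices $\mu$ in the position corresponding to $t_0$. **$k$-correct property.** A $k$-good property $\mathcal{P}$ is $k$-correct for $\mathcal{D}$ if: (1) every neighbourhood of every dynamical system in $\mathcal{D}$ contains a pleasant dynamical system; (2) for every deformation $s$ there is an admissible deformation $s'$ with $s'(0)=s(0)$, $s'(1)=s(1)$. **The group $G_n^k$ (free $k$-braids on $n$ strands).** It is generated by $\binom{n}{k}$ generators $a_m$, one for each multiindex $m\subset\{1,\dots,n\}$, $|m|=k$, subject to the relations: - (tetrahedron relations) for each ordered $(k+1)$-tuple $(u_1,\dots,u_{k+1})$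 of pairwise distinct indices, with $U=\{u_1,\dots,u_{k+1}\}$ and $m^{j}=U\setminus\{u_j\}$: $a_{m^1}a_{m^2}\cdots a_{m^{k+1}}=a_{m^{k+1}}\cdots a_{m^2}a_{m^1}$; - (far commutativity) $a_m a_{m'}=a_{m'}a_m$ whenever $\mathrm{Card}(m\cap m')<k-1$; - $a_m^2=1$ for every multiindex $m$. **The map $c$.** For a pleasant stable $D$ with type $\tau(D)=(m^1,\dots,m^N)$, the element $c(D)\in G_n^k$ is the product $a_{m^1}a_{m^2}\cdots a_{m^N}$, i.e. the product of the generators corresponding to the multiindices of the critical moments of $D$ in order of increasing $t$ from $0$ to $1$. *)

theory Defs
  imports "HOL-Analysis.Analysis" "HOL-Algebra.Group"
begin

section \<open>Dynamical systems\<close>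

definition state_space :: "nat \<Rightarrow> 'a topology \<Rightarrow> (nat \<Rightarrow> 'a) topology" where
  "state_space n S = product_topology (\<lambda>_. S) {1..n}"

text \<open>
  A map on \<open>topspace X\<close> is represented by the function that is \<open>undefined\<close> outside
  \<open>topspace X\<close>, so that equality of maps is HOL equality.
\<close>

definition cont_maps :: "'a topology \<Rightarrow> 'b topology \<Rightarrow> ('a \<Rightarrow> 'b) set" where
  "cont_maps X Y = {f \<in> extensional (topspace X). continuous_map X Y f}"

definition compact_open_topology :: "'a topology \<Rightarrow> 'b topology \<Rightarrow> ('a \<Rightarrow> 'b) topology" where
  "compact_open_topology X Y =
     topology_generated_by {{f \<in> cont_maps X Y. f ` K \<subseteq> V} | K V. compactin X K \<and> openin Y V}"

lemma topspace_compact_open_topology [simp]: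
  "topspace (compact_open_topology X Y) = cont_maps X Y"
proof -
  have "cont_maps X Y \<in> {{f \<in> cont_maps X Y. f ` K \<subseteq> V} | K V. compactin X K \<and> openin Y V}"
    by (rule CollectI, rule exI[of _ "{}"], rule exI[of _ "{}"]) auto
  then show ?thesis
    by (auto simp: compact_open_topology_def topology_generated_by_topspace)
qed

type_synonym 'a system = "real \<Rightarrow> nat \<Rightarrow> 'a"

definition system_space :: "nat \<Rightarrow> 'a topology \<Rightarrow> 'a system topology" where
  "system_space n S = compact_open_topology (top_of_set {0..1}) (state_space n S)"

definition admissible_systems :: "nat \<Rightarrow> 'a topology \<Rightarrow> 'a system set \<Rightarrow> bool" where
  "admissible_systems n S \<D> \<longleftrightarrow>
     closedin (system_space n S) \<D> \<and> (\<exists>x y. \<forall>D\<in>\<D>. D 0 = x \<and> D 1 = y)"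

definition multiindices :: "nat \<Rightarrow> nat \<Rightarrow> nat set set" where
  "multiindices n k = {m. m \<subseteq> {1..n} \<and> card m = k}"


section \<open>Good properties, critical moments and types\<close>

text \<open>
  \<open>P x A\<close> says that at the state \<open>x\<close> the property holds for the set of those particles
  whose indices lie in \<open>A\<close>.
\<close>

type_synonym 'a property = "(nat \<Rightarrow> 'a) \<Rightarrow> nat set \<Rightarrow> bool"

definition k_good :: "nat \<Rightarrow> nat \<Rightarrow> 'a topology \<Rightarrow> 'a property \<Rightarrow> bool" where
  "k_good n k S P \<longleftrightarrow> (\<forall>x \<in> topspace (state_space n S).
     (\<forall>A B. A \<subseteq> {1..n} \<and> B \<subseteq> A \<and> P x A \<longrightarrow> P x B) \<and>
     (\<forall>A. A \<subseteq> {1..n} \<and> card A = k - 1 \<longrightarrow> P x A) \<and>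
     (\<forall>i. inj_on i {1..k+1} \<and> i ` {1..k+1} \<subseteq> {1..n} \<and> P x (i ` {1..k}) \<and> P x (i ` {2..k+1})
        \<longrightarrow> P x (i ` {1..k+1})))"

definition critical_moments :: "nat \<Rightarrow> nat \<Rightarrow> 'a property \<Rightarrow> 'a system \<Rightarrow> real set" where
  "critical_moments n k P D = {t \<in> {0..1}. \<exists>m \<in> multiindices n k. P (D t) m}"

text \<open>The critical moments at which more than one multiindex has the property.\<close>

definition multiple_moments :: "nat \<Rightarrow> nat \<Rightarrow> 'a property \<Rightarrow> 'a system \<Rightarrow> real set" where
  "multiple_moments n k P D =
     {t \<in> critical_moments n k P D. \<not> (\<exists>!m. m \<in> multiindices n k \<and> P (D t) m)}"

definition pleasant :: "nat \<Rightarrow> nat \<Rightarrow> 'a property \<Rightarrow> 'a system \<Rightarrow> bool" where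
  "pleasant n k P D \<longleftrightarrow>
     finite (critical_moments n k P D) \<and>
     (\<forall>t \<in> critical_moments n k P D. \<exists>!m. m \<in> multiindices n k \<and> P (D t) m)"

definition system_type :: "nat \<Rightarrow> nat \<Rightarrow> 'a property \<Rightarrow> 'a system \<Rightarrow> nat set list" where
  "system_type n k P D =
     map (\<lambda>t. THE m. m \<in> multiindices n k \<and> P (D t) m)
       (sorted_list_of_set (critical_moments n k P D))"

definition m_type :: "'a property \<Rightarrow> nat set \<Rightarrow> 'a system \<Rightarrow> real set" where
  "m_type P m D = {t \<in> {0..1}. P (D t) m}"

text \<open>
  A finite \<open>m\<close>-type with \<open>l\<close> elements, regarded as a point of \<open>Euclidean_space l\<close>: coordinates
  are numbered from \<open>0\<close> in increasing order, and coordinates with number at least \<open>l\<close> are \<open>0\<close>.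
\<close>

definition m_type_point :: "'a property \<Rightarrow> nat set \<Rightarrow> 'a system \<Rightarrow> nat \<Rightarrow> real" where
  "m_type_point P m D =
     (\<lambda>i. if i < card (m_type P m D) then sorted_list_of_set (m_type P m D) ! i else 0)"

text \<open>
  For a family of systems \<open>f\<close> parametrised by a space \<open>T\<close>: the number of elements of the
  \<open>m\<close>-type is finite and constant, and the \<open>m\<close>-type depends continuously on the parameter.
\<close>

definition m_type_continuous ::
    "'a property \<Rightarrow> nat set \<Rightarrow> 'b topology \<Rightarrow> ('b \<Rightarrow> 'a system) \<Rightarrow> bool" where
  "m_type_continuous P m T f \<longleftrightarrow>
     (\<exists>l. (\<forall>b \<in> topspace T. finite (m_type P m (f b)) \<and> card (m_type P m (f b)) = l) \<and>
          continuous_map T (Euclidean_space l) (\<lambda>b. m_type_point P m (f b)))"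


section \<open>Stability\<close>

definition family_space :: "nat \<Rightarrow> 'a topology \<Rightarrow> 'a system set \<Rightarrow> 'a system topology" where
  "family_space n S \<D> = subtopology (system_space n S) \<D>"

definition stable_system ::
    "nat \<Rightarrow> nat \<Rightarrow> 'a topology \<Rightarrow> 'a system set \<Rightarrow> 'a property \<Rightarrow> 'a system \<Rightarrow> bool" where
  "stable_system n k S \<D> P D \<longleftrightarrow>
     (\<exists>U. openin (family_space n S \<D>) U \<and> D \<in> U \<and>
          (\<forall>D' \<in> U. pleasant n k P D') \<and>
          (\<forall>m \<in> multiindices n k.
             m_type_continuous P m (subtopology (family_space n S \<D>) U) (\<lambda>D'. D')))"

text \<open>
  Stability without the requirement that the nearby systems be pleasant. A \<^const>\<open>stable_system\<close> system
  is pleasant, so this is the only sense in which a system that is not pleasant can be stable,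
  as the admissible deformations below demand. For a pleasant system the two notions agree:
  distinct critical moments of finitely many continuous \<open>m\<close>-types stay distinct nearby.
\<close>

definition type_stable ::
    "nat \<Rightarrow> nat \<Rightarrow> 'a topology \<Rightarrow> 'a system set \<Rightarrow> 'a property \<Rightarrow> 'a system \<Rightarrow> bool" where
  "type_stable n k S \<D> P D \<longleftrightarrow>
     (\<exists>U. openin (family_space n S \<D>) U \<and> D \<in> U \<and>
          (\<forall>m \<in> multiindices n k.
             m_type_continuous P m (subtopology (family_space n S \<D>) U) (\<lambda>D'. D')))"

lemma stable_system_imp_pleasant: "stable_system n k S \<D> P D \<Longrightarrow> pleasant n k P D"
  by (auto simp: stable_system_def)

lemma stable_system_imp_type_stable: "stable_system n k S \<D> P D \<Longrightarrow> type_stable n k S \<D> P D"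
  unfolding stable_system_def type_stable_def by blast


section \<open>Deformations\<close>

definition deformation ::
    "nat \<Rightarrow> nat \<Rightarrow> 'a topology \<Rightarrow> 'a system set \<Rightarrow> 'a property \<Rightarrow> (real \<Rightarrow> 'a system) \<Rightarrow> bool" where
  "deformation n k S \<D> P s \<longleftrightarrow>
     pathin (family_space n S \<D>) s \<and>
     pleasant n k P (s 0) \<and> stable_system n k S \<D> P (s 0) \<and>
     pleasant n k P (s 1) \<and> stable_system n k S \<D> P (s 1)"

definition equivalent_systems ::
    "nat \<Rightarrow> nat \<Rightarrow> 'a topology \<Rightarrow> 'a system set \<Rightarrow> 'a property \<Rightarrow> 'a system \<Rightarrow> 'a system \<Rightarrow> bool" where
  "equivalent_systems n k S \<D> P D0 D1 \<longleftrightarrow>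
     (\<exists>s. deformation n k S \<D> P s \<and> s 0 = D0 \<and> s 1 = D1)"

definition smooth_on_interval :: "real set \<Rightarrow> (real \<Rightarrow> real) \<Rightarrow> bool" where
  "smooth_on_interval I f \<longleftrightarrow> (\<forall>r. \<forall>u \<in> I. (deriv ^^ r) f differentiable at u)"

text \<open>
  The function \<open>u \<mapsto> \<zeta>(u)\<close> given by that coordinate of the \<open>m\<close>-type of \<open>s u\<close> which has the value
  \<open>t0\<close> at \<open>u = u0\<close>.
\<close>

definition m_type_branch ::
    "'a property \<Rightarrow> nat set \<Rightarrow> (real \<Rightarrow> 'a system) \<Rightarrow> real \<Rightarrow> real \<Rightarrow> real \<Rightarrow> real" where
  "m_type_branch P m s u0 t0 =
     (\<lambda>u. m_type_point P m (s u) (card {t \<in> m_type P m (s u0). t < t0}))"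

definition simplex_event ::
    "nat \<Rightarrow> nat \<Rightarrow> 'a property \<Rightarrow> (real \<Rightarrow> 'a system) \<Rightarrow> real \<Rightarrow> bool" where
  "simplex_event n k P s u0 \<longleftrightarrow>
     (\<exists>t0 m. multiple_moments n k P (s u0) = {t0} \<and>
        {m' \<in> multiindices n (k+1). P (s u0 t0) m'} = {m} \<and>
        (\<exists>\<epsilon>>0. {u0-\<epsilon><..<u0+\<epsilon>} \<subseteq> {0..1} \<and>
           (\<forall>j\<in>m. smooth_on_interval {u0-\<epsilon><..<u0+\<epsilon>} (m_type_branch P (m - {j}) s u0 t0))) \<and>
        inj_on (\<lambda>j. deriv (m_type_branch P (m - {j}) s u0 t0) u0) m)"

definition far_event ::
    "nat \<Rightarrow> nat \<Rightarrow> 'a property \<Rightarrow> (real \<Rightarrow> 'a system) \<Rightarrow> real \<Rightarrow> bool" where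
  "far_event n k P s u0 \<longleftrightarrow>
     (\<exists>t0 m m'. multiple_moments n k P (s u0) = {t0} \<and> m \<noteq> m' \<and>
        {\<mu> \<in> multiindices n k. P (s u0 t0) \<mu>} = {m, m'} \<and>
        card (m \<inter> m') < k - 1)"

definition pair_inserted :: "nat \<Rightarrow> 'b \<Rightarrow> 'b list \<Rightarrow> 'b list \<Rightarrow> bool" where
  "pair_inserted p \<mu> xs ys \<longleftrightarrow> p \<le> length xs \<and> ys = take p xs @ [\<mu>, \<mu>] @ drop p xs"

text \<open>
  The position in the list of multiindices that corresponds to a non-critical moment \<open>t0\<close> of
  \<open>s u\<close> is the number of critical moments of \<open>s u\<close> before \<open>t0\<close>.
\<close>

definition cancellation_event ::
    "nat \<Rightarrow> nat \<Rightarrow> 'a topology \<Rightarrow> 'a system set \<Rightarrow> 'a property \<Rightarrow> (real \<Rightarrow> 'a system) \<Rightarrow> real \<Rightarrow> bool"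
    where
  "cancellation_event n k S \<D> P s u \<longleftrightarrow>
     (\<exists>t0 \<in> {0..1} - critical_moments n k P (s u). \<exists>\<mu> \<in> multiindices n k. \<exists>\<epsilon>>0.
        {u-\<epsilon><..<u+\<epsilon>} \<subseteq> {0..1} \<and>
        (\<forall>u' \<in> {u-\<epsilon><..<u} \<union> {u<..<u+\<epsilon>}. stable_system n k S \<D> P (s u')) \<and>
        (\<forall>\<delta>. 0 < \<delta> \<and> \<delta> < \<epsilon> \<longrightarrow>
           (let p = card {t \<in> critical_moments n k P (s u). t < t0};
                before = system_type n k P (s (u - \<delta>));
                after = system_type n k P (s (u + \<delta>))
            in pair_inserted p \<mu> before after \<or> pair_inserted p \<mu> after before)))"

definition admissible_deformation ::
    "nat \<Rightarrow> nat \<Rightarrow> 'a topology \<Rightarrow> 'a system set \<Rightarrow> 'a property \<Rightarrow> (real \<Rightarrow> 'a system) \<Rightarrow> bool" where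
  "admissible_deformation n k S \<D> P s \<longleftrightarrow>
     deformation n k S \<D> P s \<and>
     finite {u \<in> {0..1}. \<not> pleasant n k P (s u) \<or> \<not> stable_system n k S \<D> P (s u)} \<and>
     (\<forall>u \<in> {0..1}. \<not> pleasant n k P (s u) \<longrightarrow> type_stable n k S \<D> P (s u)) \<and>
     (\<forall>I. is_interval I \<and> I \<subseteq> {0..1} \<and> (\<forall>u\<in>I. stable_system n k S \<D> P (s u)) \<longrightarrow>
        (\<forall>m \<in> multiindices n k. m_type_continuous P m (top_of_set I) s)) \<and>
     (\<forall>u \<in> {0..1}. \<not> pleasant n k P (s u) \<longrightarrow>
        (simplex_event n k P s u \<or> far_event n k P s u) \<and>
        \<not> (simplex_event n k P s u \<and> far_event n k P s u)) \<and>
     (\<forall>u \<in> {0..1}. \<not> type_stable n k S \<D> P (s u) \<longrightarrow> cancellation_event n k S \<D> P s u)"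

text \<open>
  If stability is read as \<^const>\<open>stable_system\<close> throughout, then systems along the deformation
  that are not pleasant are ruled out altogether; such deformations are admissible here as well.
\<close>

lemma admissible_deformation_if_stable_throughout:
  assumes "deformation n k S \<D> P s"
    and "finite {u \<in> {0..1}. \<not> pleasant n k P (s u) \<or> \<not> stable_system n k S \<D> P (s u)}"
    and "\<forall>u \<in> {0..1}. \<not> pleasant n k P (s u) \<longrightarrow> stable_system n k S \<D> P (s u)"
    and "\<forall>I. is_interval I \<and> I \<subseteq> {0..1} \<and> (\<forall>u\<in>I. stable_system n k S \<D> P (s u)) \<longrightarrow>
          (\<forall>m \<in> multiindices n k. m_type_continuous P m (top_of_set I) s)"
    and "\<forall>u \<in> {0..1}. \<not> stable_system n k S \<D> P (s u) \<longrightarrow> cancellation_event n k S \<D> P s u"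
  shows "admissible_deformation n k S \<D> P s"
proof -
  have "pleasant n k P (s u)" if "u \<in> {0..1}" for u
    using assms(3) that stable_system_imp_pleasant by metis
  moreover have "cancellation_event n k S \<D> P s u"
    if "u \<in> {0..1}" "\<not> type_stable n k S \<D> P (s u)" for u
    using assms(5) that stable_system_imp_type_stable by metis
  ultimately show ?thesis
    unfolding admissible_deformation_def using assms(1,2,4) by (intro conjI) simp_all
qed

definition k_correct ::
    "nat \<Rightarrow> nat \<Rightarrow> 'a topology \<Rightarrow> 'a system set \<Rightarrow> 'a property \<Rightarrow> bool" where
  "k_correct n k S \<D> P \<longleftrightarrow>
     k_good n k S P \<and>
     (\<forall>D\<in>\<D>. \<forall>U. openin (family_space n S \<D>) U \<and> D \<in> U \<longrightarrow> (\<exists>D'\<in>U. pleasant n k P D')) \<and>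
     (\<forall>s. deformation n k S \<D> P s \<longrightarrow>
        (\<exists>s'. admissible_deformation n k S \<D> P s' \<and> s' 0 = s 0 \<and> s' 1 = s 1))"


section \<open>Groups given by generators and relations\<close>

text \<open>
  Words are lists of letters \<open>(a, b)\<close>, where \<open>(a, True)\<close> stands for the generator \<open>a\<close> and
  \<open>(a, False)\<close> for its inverse.
\<close>

type_synonym 'g word = "('g \<times> bool) list"

definition pos_word :: "'g list \<Rightarrow> 'g word" where
  "pos_word = map (\<lambda>a. (a, True))"

inductive_set presentation_rel :: "'g set \<Rightarrow> ('g word \<times> 'g word) set \<Rightarrow> ('g word \<times> 'g word) set"
  for A :: "'g set" and R :: "('g word \<times> 'g word) set" where
  refl: "w \<in> lists (A \<times> UNIV) \<Longrightarrow> (w, w) \<in> presentation_rel A R"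
| sym: "(v, w) \<in> presentation_rel A R \<Longrightarrow> (w, v) \<in> presentation_rel A R"
| trans: "(u, v) \<in> presentation_rel A R \<Longrightarrow> (v, w) \<in> presentation_rel A R \<Longrightarrow>
    (u, w) \<in> presentation_rel A R"
| cancel: "u \<in> lists (A \<times> UNIV) \<Longrightarrow> v \<in> lists (A \<times> UNIV) \<Longrightarrow> a \<in> A \<Longrightarrow>
    (u @ [(a, b), (a, \<not> b)] @ v, u @ v) \<in> presentation_rel A R"
| rel: "u \<in> lists (A \<times> UNIV) \<Longrightarrow> v \<in> lists (A \<times> UNIV) \<Longrightarrow> (r, r') \<in> R \<Longrightarrow>
    r \<in> lists (A \<times> UNIV) \<Longrightarrow> r' \<in> lists (A \<times> UNIV) \<Longrightarrow>
    (u @ r @ v, u @ r' @ v) \<in> presentation_rel A R"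

definition presented_group :: "'g set \<Rightarrow> ('g word \<times> 'g word) set \<Rightarrow> 'g word set monoid" where
  "presented_group A R =
     \<lparr>carrier = lists (A \<times> UNIV) // presentation_rel A R,
      mult = (\<lambda>X Y. \<Union>x\<in>X. \<Union>y\<in>Y. presentation_rel A R `` {x @ y}),
      one = presentation_rel A R `` {[]}\<rparr>"

lemma presentation_rel_words:
  "(v, w) \<in> presentation_rel A R \<Longrightarrow> v \<in> lists (A \<times> UNIV) \<and> w \<in> lists (A \<times> UNIV)"
  by (induction rule: presentation_rel.induct) auto

lemma equiv_presentation_rel: "equiv (lists (A \<times> UNIV)) (presentation_rel A R)"
proof (rule equivI)
  show "presentation_rel A R \<subseteq> lists (A \<times> UNIV) \<times> lists (A \<times> UNIV)"
    using presentation_rel_words by (metis SigmaI subrelI)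
  show "refl_on (lists (A \<times> UNIV)) (presentation_rel A R)"
    by (auto intro!: refl_onI presentation_rel.refl)
  show "sym (presentation_rel A R)"
    by (rule symI) (rule presentation_rel.sym)
  show "trans (presentation_rel A R)"
    by (rule transI) (rule presentation_rel.trans)
qed

lemma presentation_rel_context:
  assumes "(v, w) \<in> presentation_rel A R" "x \<in> lists (A \<times> UNIV)" "y \<in> lists (A \<times> UNIV)"
  shows "(x @ v @ y, x @ w @ y) \<in> presentation_rel A R"
  using assms
proof (induction rule: presentation_rel.induct)
  case (refl w)
  then show ?case by (intro presentation_rel.refl) auto
next
  case (sym v w)
  then show ?case by (blast intro: presentation_rel.sym)
next
  case (trans u v w)
  then show ?case by (blast intro: presentation_rel.trans)
next
  case (cancel u v a b)
  then show ?case using presentation_rel.cancel[of "x @ u" A "v @ y" a b R] by auto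
next
  case (rel u v r r')
  then show ?case using presentation_rel.rel[of "x @ u" A "v @ y" r r' R] by auto
qed

lemma presentation_rel_append:
  assumes "(v, w) \<in> presentation_rel A R" "(v', w') \<in> presentation_rel A R"
  shows "(v @ v', w @ w') \<in> presentation_rel A R"
  using presentation_rel_context[OF assms(1), of "[]" v'] presentation_rel_words[OF assms(2)]
    presentation_rel_context[OF assms(2), of w "[]"] presentation_rel_words[OF assms(1)]
  by (auto intro: presentation_rel.trans)

lemma presented_group_mult_class:
  assumes "x \<in> lists (A \<times> UNIV)" "y \<in> lists (A \<times> UNIV)"
  shows "(presentation_rel A R `` {x}) \<otimes>\<^bsub>presented_group A R\<^esub> (presentation_rel A R `` {y})
    = presentation_rel A R `` {x @ y}"
proof -
  have "presentation_rel A R `` {x' @ y'} = presentation_rel A R `` {x @ y}"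
    if "(x, x') \<in> presentation_rel A R" "(y, y') \<in> presentation_rel A R" for x' y'
    using equiv_class_eq[OF equiv_presentation_rel presentation_rel_append[OF that]] by simp
  then show ?thesis
    using assms by (auto simp: presented_group_def intro: presentation_rel.refl)
qed

lemma presentation_rel_inverse:
  assumes "w \<in> lists (A \<times> UNIV)"
  shows "(map (\<lambda>(a, b). (a, \<not> b)) (rev w) @ w, []) \<in> presentation_rel A R"
  using assms
proof (induction w)
  case Nil
  then show ?case by (auto intro: presentation_rel.refl)
next
  case (Cons l w)
  obtain a b where l: "l = (a, b)" by (cases l)
  have "(map (\<lambda>(a, b). (a, \<not> b)) (rev w) @ [(a, \<not> b), (a, \<not> \<not> b)] @ w,
      map (\<lambda>(a, b). (a, \<not> b)) (rev w) @ w) \<in> presentation_rel A R"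
    using Cons by (intro presentation_rel.cancel) (auto simp: l)
  then show ?case
    using Cons by (auto simp: l intro: presentation_rel.trans)
qed

lemma group_presented_group: "group (presented_group A R)"
proof (rule groupI)
  fix X Y assume "X \<in> carrier (presented_group A R)" "Y \<in> carrier (presented_group A R)"
  then obtain x y where xy:
    "X = presentation_rel A R `` {x}" "Y = presentation_rel A R `` {y}"
    "x \<in> lists (A \<times> UNIV)" "y \<in> lists (A \<times> UNIV)"
    by (auto simp: presented_group_def elim!: quotientE)
  then have "X \<otimes>\<^bsub>presented_group A R\<^esub> Y = presentation_rel A R `` {x @ y}"
    by (simp only: presented_group_mult_class)
  moreover have "x @ y \<in> lists (A \<times> UNIV)"
    using xy by auto
  ultimately show "X \<otimes>\<^bsub>presented_group A R\<^esub> Y \<in> carrier (presented_group A R)"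
    by (auto simp: presented_group_def intro!: quotientI)
next
  show "\<one>\<^bsub>presented_group A R\<^esub> \<in> carrier (presented_group A R)"
    by (auto simp: presented_group_def intro!: quotientI)
next
  fix X Y Z
  assume "X \<in> carrier (presented_group A R)" "Y \<in> carrier (presented_group A R)"
    "Z \<in> carrier (presented_group A R)"
  then obtain x y z where
    "X = presentation_rel A R `` {x}" "Y = presentation_rel A R `` {y}"
    "Z = presentation_rel A R `` {z}"
    "x \<in> lists (A \<times> UNIV)" "y \<in> lists (A \<times> UNIV)" "z \<in> lists (A \<times> UNIV)"
    by (auto simp: presented_group_def elim!: quotientE)
  moreover from this have "x @ y \<in> lists (A \<times> UNIV)" "y @ z \<in> lists (A \<times> UNIV)"
    by auto
  ultimately show "X \<otimes>\<^bsub>presented_group A R\<^esub> Y \<otimes>\<^bsub>presented_group A R\<^esub> Z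
      = X \<otimes>\<^bsub>presented_group A R\<^esub> (Y \<otimes>\<^bsub>presented_group A R\<^esub> Z)"
    by (simp only: presented_group_mult_class append_assoc)
next
  fix X assume "X \<in> carrier (presented_group A R)"
  then obtain x where X: "X = presentation_rel A R `` {x}" and x: "x \<in> lists (A \<times> UNIV)"
    by (auto simp: presented_group_def elim!: quotientE)
  have one: "\<one>\<^bsub>presented_group A R\<^esub> = presentation_rel A R `` {[]}"
    by (simp add: presented_group_def)
  show "\<one>\<^bsub>presented_group A R\<^esub> \<otimes>\<^bsub>presented_group A R\<^esub> X = X"
    unfolding one X using presented_group_mult_class[of "[]" A x R] x by simp
  define y where "y = map (\<lambda>(a, b). (a, \<not> b)) (rev x)"
  have y: "y \<in> lists (A \<times> UNIV)"
    using x by (auto simp: y_def)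
  have "presentation_rel A R `` {y} \<otimes>\<^bsub>presented_group A R\<^esub> X = \<one>\<^bsub>presented_group A R\<^esub>"
    unfolding one X presented_group_mult_class[OF y x]
    using equiv_class_eq[OF equiv_presentation_rel presentation_rel_inverse[OF x, folded y_def]] .
  moreover have "presentation_rel A R `` {y} \<in> carrier (presented_group A R)"
    using y by (auto simp: presented_group_def intro!: quotientI)
  ultimately show "\<exists>Y\<in>carrier (presented_group A R).
      Y \<otimes>\<^bsub>presented_group A R\<^esub> X = \<one>\<^bsub>presented_group A R\<^esub>"
    by blast
qed


section \<open>Free \<open>k\<close>-braids\<close>

definition tetrahedron_relations :: "nat \<Rightarrow> nat \<Rightarrow> (nat set word \<times> nat set word) set" where
  "tetrahedron_relations n k =
     {(pos_word (map (\<lambda>x. set us - {x}) us), pos_word (rev (map (\<lambda>x. set us - {x}) us))) | us.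
        length us = k + 1 \<and> distinct us \<and> set us \<subseteq> {1..n}}"

definition far_commutativity_relations :: "nat \<Rightarrow> nat \<Rightarrow> (nat set word \<times> nat set word) set" where
  "far_commutativity_relations n k =
     {(pos_word [m, m'], pos_word [m', m]) | m m'.
        m \<in> multiindices n k \<and> m' \<in> multiindices n k \<and> card (m \<inter> m') < k - 1}"

definition involution_relations :: "nat \<Rightarrow> nat \<Rightarrow> (nat set word \<times> nat set word) set" where
  "involution_relations n k = {(pos_word [m, m], []) | m. m \<in> multiindices n k}"

definition free_braid_relations :: "nat \<Rightarrow> nat \<Rightarrow> (nat set word \<times> nat set word) set" where
  "free_braid_relations n k =
     tetrahedron_relations n k \<union> far_commutativity_relations n k \<union> involution_relations n k"

definition free_braid_group :: "nat \<Rightarrow> nat \<Rightarrow> nat set word set monoid" where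
  "free_braid_group n k = presented_group (multiindices n k) (free_braid_relations n k)"

definition braid_gen :: "nat \<Rightarrow> nat \<Rightarrow> nat set \<Rightarrow> nat set word set" where
  "braid_gen n k m =
     presentation_rel (multiindices n k) (free_braid_relations n k) `` {pos_word [m]}"

definition braid_of_system :: "nat \<Rightarrow> nat \<Rightarrow> 'a property \<Rightarrow> 'a system \<Rightarrow> nat set word set" where
  "braid_of_system n k P D =
     foldr (\<lambda>m g. braid_gen n k m \<otimes>\<^bsub>free_braid_group n k\<^esub> g) (system_type n k P D)
       \<one>\<^bsub>free_braid_group n k\<^esub>"

end

theory Submission
  imports Defs
begin

text \<open>
  Correctness of the property replaces the given deformation by an admissible one, \<open>s\<close>, and the
  claim becomes that the braid spelled by the type of \<open>s u\<close> does not depend on the parameter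
  \<open>u\<close>, as long as \<open>s u\<close> is stable. The parameters with \<open>s u\<close> not stable are finite in number, so
  stable parameters are dense in \<open>[0,1]\<close>, and connectedness of \<open>[0,1]\<close> reduces the claim to a local
  one: each \<open>u0\<close> has a neighbourhood on which all stable parameters give the same braid
  (\<open>admissible_deformation_braid_eq\<close>).

  If the \<open>m\<close>-types are continuous at \<open>u0\<close>, each critical moment \<open>t\<close> of \<open>s u0\<close> can be followed along
  one branch for every multiindex \<open>m\<close> which has the property at \<open>t\<close>. Near \<open>u0\<close> the branches
  that start at different moments stay in disjoint intervals, so the type of \<open>s u\<close> is a concatenation
  of words, one for each critical moment of \<open>s u0\<close>, and each word lists the same multiindices for all
  \<open>u\<close>, in the order of their branches (\<open>cluster_word_letters\<close>, \<open>system_type_clusters\<close>). Only the word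
  at a moment that carries several multiindices can vary (\<open>braid_eq_near_type_stable\<close>), and the two
  kinds of events allowed there account for its variation:

  \<^item> At a far event the word consists of two letters that commute.

  \<^item> At a simplex event, the branches of the \<open>k + 1\<close> faces of a \<open>(k+1)\<close>-element set \<open>m\<close> pass \<open>t\<close> with
    distinct velocities. Their order for \<open>u < u0\<close> is therefore the reverse of their order for
    \<open>u > u0\<close>, and the tetrahedron relation identifies the two. Further multiindices may have
    the property at the same moment. If two multiindices share \<open>k - 1\<close> elements, a good property
    passes to their union, which can only be \<open>m\<close>; so a multiindex that is not a face of \<open>m\<close> commutes
    with all the others (\<open>far_from_simplex\<close>) and can be moved out of the way.

  If the \<open>m\<close>-types are not continuous at \<open>u0\<close>, the types on the two sides of \<open>u0\<close> differ by two equal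
  adjacent letters, which cancel because the generators are involutions. On each side
  the braid is constant by the first case, so comparing one pair of parameters is enough
  (\<open>cancellation_braid_eq\<close>).
\<close>

section \<open>Words in the generators of the free braid group\<close>

abbreviation braid_eq :: "nat \<Rightarrow> nat \<Rightarrow> nat set list \<Rightarrow> nat set list \<Rightarrow> bool" where
  "braid_eq n k xs ys \<equiv>
     (pos_word xs, pos_word ys) \<in> presentation_rel (multiindices n k) (free_braid_relations n k)"

lemma pos_word_append: "pos_word (xs @ ys) = pos_word xs @ pos_word ys"
  by (simp add: pos_word_def)

lemma pos_word_in_lists: "pos_word xs \<in> lists (A \<times> UNIV) \<longleftrightarrow> set xs \<subseteq> A"
  by (auto simp: pos_word_def lists_eq_set)

lemma finite_multiindices: "finite (multiindices n k)"
  by (rule finite_subset[of _ "Pow {1..n}"]) (auto simp: multiindices_def)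

lemma finite_multiindex: "m \<in> multiindices n k \<Longrightarrow> finite m"
  unfolding multiindices_def by (metis finite_atLeastAtMost finite_subset mem_Collect_eq)

lemma braid_eq_refl: "set xs \<subseteq> multiindices n k \<Longrightarrow> braid_eq n k xs xs"
  by (simp add: presentation_rel.refl pos_word_in_lists)

lemma braid_eq_sym: "braid_eq n k xs ys \<Longrightarrow> braid_eq n k ys xs"
  by (rule presentation_rel.sym)

lemma braid_eq_trans [trans]:
  "braid_eq n k xs ys \<Longrightarrow> braid_eq n k ys zs \<Longrightarrow> braid_eq n k xs zs"
  by (rule presentation_rel.trans)

lemma braid_eq_append:
  "braid_eq n k xs ys \<Longrightarrow> braid_eq n k xs' ys' \<Longrightarrow> braid_eq n k (xs @ xs') (ys @ ys')"
  by (simp add: pos_word_append presentation_rel_append)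

lemma braid_eq_Cons:
  "braid_eq n k xs ys \<Longrightarrow> a \<in> multiindices n k \<Longrightarrow> braid_eq n k (a # xs) (a # ys)"
  using braid_eq_append[of "[a]" "[a]" n k xs ys] braid_eq_refl[of "[a]" n k] by simp

lemma braid_eq_concat:
  "(\<And>t. t \<in> set ts \<Longrightarrow> braid_eq n k (f t) (g t)) \<Longrightarrow>
     braid_eq n k (concat (map f ts)) (concat (map g ts))"
  by (induction ts) (auto intro: braid_eq_refl braid_eq_append)

lemma braid_eq_relation:
  assumes "(pos_word xs, pos_word ys) \<in> free_braid_relations n k"
    and "set xs \<subseteq> multiindices n k" "set ys \<subseteq> multiindices n k"
  shows "braid_eq n k xs ys"
  using presentation_rel.rel[of "[]" "multiindices n k" "[]", OF _ _ assms(1)] assms(2,3)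
  by (simp add: pos_word_in_lists)

lemma braid_eq_involution:
  "m \<in> multiindices n k \<Longrightarrow> braid_eq n k [m, m] []"
  by (rule braid_eq_relation)
     (auto simp: free_braid_relations_def involution_relations_def pos_word_def)

lemma braid_eq_tetrahedron:
  assumes "distinct us" "length us = k + 1" "set us \<subseteq> {1..n}"
  shows "braid_eq n k (map (\<lambda>x. set us - {x}) us) (rev (map (\<lambda>x. set us - {x}) us))"
proof -
  have "card (set us) = k + 1"
    using assms by (simp add: distinct_card)
  then have "set (map (\<lambda>x. set us - {x}) us) \<subseteq> multiindices n k"
    using assms(3) by (auto simp: multiindices_def)
  moreover have "(pos_word (map (\<lambda>x. set us - {x}) us), pos_word (rev (map (\<lambda>x. set us - {x}) us)))
      \<in> free_braid_relations n k"
    using assms by (auto simp: free_braid_relations_def tetrahedron_relations_def)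
  ultimately show ?thesis
    by (intro braid_eq_relation) auto
qed

lemma braid_eq_pair_inserted:
  assumes "pair_inserted p \<mu> xs ys" "set xs \<subseteq> multiindices n k" "\<mu> \<in> multiindices n k"
  shows "braid_eq n k xs ys"
proof -
  have "set (take p xs) \<subseteq> multiindices n k" "set (drop p xs) \<subseteq> multiindices n k"
    using assms(2) set_take_subset[of p xs] set_drop_subset[of p xs] by auto
  then have "braid_eq n k (take p xs @ [] @ drop p xs) (take p xs @ [\<mu>, \<mu>] @ drop p xs)"
    by (intro braid_eq_append braid_eq_refl braid_eq_sym[OF braid_eq_involution[OF assms(3)]])
  then show ?thesis
    using assms(1) by (simp add: pair_inserted_def)
qed

text \<open>
  The word \<open>ys\<close> after the letter that moves is included so that the lemma rewrites a letter in the
  middle of a word.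
\<close>

lemma braid_eq_move_to_front:
  assumes "a \<in> multiindices n k" "set xs \<subseteq> multiindices n k" "set ys \<subseteq> multiindices n k"
    and "\<And>b. b \<in> set xs \<Longrightarrow> card (a \<inter> b) < k - 1"
  shows "braid_eq n k (xs @ a # ys) (a # xs @ ys)"
  using assms(2,4)
proof (induction xs)
  case Nil
  then show ?case using assms by (simp add: braid_eq_refl)
next
  case (Cons b xs)
  have "braid_eq n k ((b # xs) @ a # ys) ([b, a] @ (xs @ ys))"
    using braid_eq_Cons[OF Cons.IH, of b] Cons.prems by simp
  also have "braid_eq n k [b, a] [a, b]"
    using Cons.prems assms(1)
    by (intro braid_eq_relation)
       (auto simp: free_braid_relations_def far_commutativity_relations_def Int_commute)
  then have "braid_eq n k ([b, a] @ (xs @ ys)) ([a, b] @ (xs @ ys))"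
    using Cons.prems assms(3) by (intro braid_eq_append braid_eq_refl) auto
  finally show ?case
    by simp
qed

text \<open>
  Pairwise far letters commute pairwise, so the order of such letters is immaterial.
\<close>

lemma braid_eq_far_permutation:
  assumes "distinct xs" "distinct ys" "set xs = set ys" "set xs \<subseteq> multiindices n k"
    and "\<And>a b. a \<in> set xs \<Longrightarrow> b \<in> set xs \<Longrightarrow> a \<noteq> b \<Longrightarrow> card (a \<inter> b) < k - 1"
  shows "braid_eq n k xs ys"
  using assms
proof (induction xs arbitrary: ys)
  case Nil
  then show ?case by (simp add: braid_eq_refl)
next
  case (Cons a xs)
  obtain us vs where ys: "ys = us @ a # vs"
    using Cons.prems(3) by (metis list.set_intros(1) split_list)
  have sets: "set us \<subseteq> set xs" "set vs \<subseteq> set xs" "set (us @ vs) = set xs" "distinct (us @ vs)"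
    using Cons.prems(1-3) unfolding ys by auto
  have "braid_eq n k xs (us @ vs)"
  proof (rule Cons.IH)
    show "card (c \<inter> b) < k - 1" if "c \<in> set xs" "b \<in> set xs" "c \<noteq> b" for c b
      using Cons.prems(5)[of c b] that by simp
  qed (use Cons.prems sets in auto)
  then have "braid_eq n k (a # xs) (a # us @ vs)"
    using Cons.prems(4) by (intro braid_eq_Cons) auto
  also have "braid_eq n k (a # us @ vs) ys"
    unfolding ys
  proof (rule braid_eq_sym[OF braid_eq_move_to_front])
    fix b assume "b \<in> set us"
    with sets have "b \<in> set xs" by auto
    then show "card (a \<inter> b) < k - 1"
      using Cons.prems(1,5) by auto
  qed (use Cons.prems(4) sets in auto)
  finally show ?case .
qed

text \<open>
  The normal form used at a simplex event: letters that commute with all letters of the other kind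
  are collected in front, and neither kind is reordered.
\<close>

lemma braid_eq_partition:
  assumes "set w \<subseteq> multiindices n k"
    and "\<And>a b. a \<in> set w \<Longrightarrow> b \<in> set w \<Longrightarrow> F a \<Longrightarrow> \<not> F b \<Longrightarrow> card (a \<inter> b) < k - 1"
  shows "braid_eq n k w (filter F w @ filter (\<lambda>a. \<not> F a) w)"
  using assms
proof (induction w)
  case Nil
  then show ?case by (simp add: braid_eq_refl)
next
  case (Cons a w)
  let ?F = "filter F w" and ?G = "filter (\<lambda>a. \<not> F a) w"
  have *: "braid_eq n k (a # w) (a # ?F @ ?G)"
    using Cons by (intro braid_eq_Cons Cons.IH) auto
  show ?case
  proof (cases "F a")
    case True
    with * show ?thesis by simp
  next
    case False
    have "braid_eq n k (?F @ a # ?G) (a # ?F @ ?G)"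
    proof (rule braid_eq_move_to_front)
      fix b assume "b \<in> set ?F"
      with Cons.prems(2)[of b a] False show "card (a \<inter> b) < k - 1"
        by (auto simp: Int_commute)
    qed (use Cons.prems(1) in auto)
    with * False show ?thesis
      using braid_eq_trans[OF * braid_eq_sym] by simp
  qed
qed

lemma braid_of_system_eq_class:
  assumes "set (system_type n k P D) \<subseteq> multiindices n k"
  shows "braid_of_system n k P D =
    presentation_rel (multiindices n k) (free_braid_relations n k) `` {pos_word (system_type n k P D)}"
proof -
  have "foldr (\<lambda>m g. braid_gen n k m \<otimes>\<^bsub>free_braid_group n k\<^esub> g) w \<one>\<^bsub>free_braid_group n k\<^esub> =
      presentation_rel (multiindices n k) (free_braid_relations n k) `` {pos_word w}"
    if "set w \<subseteq> multiindices n k" for w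
    using that
  proof (induction w)
    case Nil
    then show ?case by (simp add: free_braid_group_def presented_group_def pos_word_def)
  next
    case (Cons m w)
    have "pos_word [m] @ pos_word w = pos_word (m # w)"
      by (simp add: pos_word_def)
    moreover have "pos_word [m] \<in> lists (multiindices n k \<times> UNIV)"
      "pos_word w \<in> lists (multiindices n k \<times> UNIV)"
      using Cons.prems by (simp_all add: pos_word_in_lists)
    ultimately show ?case
      using Cons by (simp add: braid_gen_def free_braid_group_def presented_group_mult_class)
  qed
  from this[OF assms] show ?thesis
    by (simp add: braid_of_system_def)
qed

lemma set_system_type:
  assumes "pleasant n k P D"
  shows "set (system_type n k P D) \<subseteq> multiindices n k"
proof -
  have "(THE m. m \<in> multiindices n k \<and> P (D t) m) \<in> multiindices n k"
    if "t \<in> critical_moments n k P D" for t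
    using that assms theI'[of "\<lambda>m. m \<in> multiindices n k \<and> P (D t) m"]
    by (auto simp: pleasant_def)
  then show ?thesis
    using assms by (auto simp: system_type_def pleasant_def)
qed

lemma braid_of_system_eqI:
  assumes "pleasant n k P D" "pleasant n k P D'"
    and "braid_eq n k (system_type n k P D) (system_type n k P D')"
  shows "braid_of_system n k P D = braid_of_system n k P D'"
  using equiv_class_eq[OF equiv_presentation_rel assms(3)]
  by (simp add: braid_of_system_eq_class set_system_type assms)


section \<open>Enumerations sorted by a real-valued key\<close>

text \<open>
  Since a strictly sorted enumeration is determined by its set, the order of the branches fixes the
  word that the critical moments near a given moment spell.
\<close>

lemma sorted_wrt_key_unique:
  fixes f :: "'b \<Rightarrow> real"
  assumes "sorted_wrt (\<lambda>a b. f a < f b) xs" "sorted_wrt (\<lambda>a b. f a < f b) ys" "set xs = set ys"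
  shows "xs = ys"
proof -
  have "map f xs = map f ys"
    using assms by (intro strict_sorted_equal) (auto simp: sorted_wrt_map)
  moreover have "inj_on f (set xs \<union> set ys)"
    using assms strict_sorted_iff[of "map f xs"] by (simp add: sorted_wrt_map distinct_map)
  ultimately show ?thesis
    using map_inj_on by blast
qed

lemma sorted_wrt_key_distinct:
  fixes f :: "'b \<Rightarrow> real"
  assumes "sorted_wrt (\<lambda>a b. f a < f b) xs"
  shows "distinct xs"
  using assms by (induction xs) auto

lemma sorted_wrt_key_exists:
  fixes f :: "'b \<Rightarrow> real"
  assumes "finite A" "inj_on f A"
  obtains xs where "set xs = A" "sorted_wrt (\<lambda>a b. f a < f b) xs"
proof
  let ?xs = "map (inv_into A f) (sorted_list_of_set (f ` A))"
  show "set ?xs = A"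
    using assms by (auto simp: inv_into_into image_image)
  show "sorted_wrt (\<lambda>a b. f a < f b) ?xs"
    using assms(1) by (auto simp: sorted_wrt_map f_inv_into_f
      intro: sorted_wrt_mono_rel[OF _ sorted_list_of_set.strict_sorted_key_list_of_set])
qed

text \<open>
  Branches of \<open>m\<close>-types are indexed by the number of smaller elements. This lemma and the next one say
  that this number is the position in the increasing enumeration.
\<close>

lemma card_less_nth_sorted_list_of_set:
  fixes X :: "real set"
  assumes "finite X" "i < card X"
  shows "card {x \<in> X. x < sorted_list_of_set X ! i} = i"
proof -
  let ?xs = "sorted_list_of_set X"
  have len: "length ?xs = card X" and set: "set ?xs = X" and sorted: "sorted_wrt (<) ?xs"
    using assms by auto
  have less: "?xs ! j < ?xs ! i \<longleftrightarrow> j < i" if "j < card X" for j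
    using sorted_wrt_nth_less[OF sorted, of j i] sorted_wrt_nth_less[OF sorted, of i j] that assms len
    by (metis less_asym linorder_less_linear less_irrefl)
  have "{x \<in> X. x < ?xs ! i} = (!) ?xs ` {..<i}"
  proof (intro equalityI subsetI)
    fix x assume "x \<in> {x \<in> X. x < ?xs ! i}"
    then obtain j where "j < card X" "x = ?xs ! j" "?xs ! j < ?xs ! i"
      using set len by (metis (lifting) in_set_conv_nth mem_Collect_eq)
    with less show "x \<in> (!) ?xs ` {..<i}" by auto
  next
    fix x assume "x \<in> (!) ?xs ` {..<i}"
    then obtain j where "j < i" "x = ?xs ! j" by auto
    then show "x \<in> {x \<in> X. x < ?xs ! i}"
      using less[of j] assms len nth_mem[of j ?xs] set by auto
  qed
  moreover have "inj_on ((!) ?xs) {..<i}"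
    using assms len by (intro inj_on_nth) auto
  ultimately show ?thesis
    by (simp add: card_image)
qed

lemma nth_sorted_list_of_set_card_less:
  fixes X :: "real set"
  assumes "finite X" "t \<in> X"
  shows "card {x \<in> X. x < t} < card X" "sorted_list_of_set X ! card {x \<in> X. x < t} = t"
proof -
  obtain i where "i < card X" "t = sorted_list_of_set X ! i"
    using assms by (metis in_set_conv_nth length_sorted_list_of_set set_sorted_list_of_set)
  then show "card {x \<in> X. x < t} < card X" "sorted_list_of_set X ! card {x \<in> X. x < t} = t"
    using card_less_nth_sorted_list_of_set[OF assms(1)] by auto
qed

text \<open>
  With centres at distance at least \<open>2 * r\<close> from each other, points in balls of radius \<open>r\<close> are
  ordered as the centres are, so the clusters can be enumerated one after the other.
\<close>

lemma sorted_list_of_set_clusters: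
  fixes C X :: "real set"
  assumes "finite C" "finite X" "X \<subseteq> (\<Union>t\<in>C. ball t r)"
    and "\<forall>t\<in>C. \<forall>t'\<in>C. t \<noteq> t' \<longrightarrow> 2 * r \<le> \<bar>t - t'\<bar>"
  shows "sorted_list_of_set X =
    concat (map (\<lambda>t. sorted_list_of_set (X \<inter> ball t r)) (sorted_list_of_set C))"
proof -
  have "sorted_wrt (<) (concat (map (\<lambda>t. sorted_list_of_set (X \<inter> ball t r)) ts))"
    if "sorted_wrt (<) ts" "set ts \<subseteq> C" for ts
    using that
  proof (induction ts)
    case (Cons t ts)
    have "x < y" if "x \<in> X \<inter> ball t r" "t' \<in> set ts" "y \<in> X \<inter> ball t' r" for x y t'
    proof -
      have "t < t'" "2 * r \<le> \<bar>t - t'\<bar>"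
        using Cons.prems that(2) assms(4)[rule_format, of t t'] by auto
      then show ?thesis
        using that(1,3) by (auto simp: dist_real_def)
    qed
    with Cons assms(2) show ?case
      by (auto simp: sorted_wrt_append)
  qed simp
  then have "sorted_wrt (<) (concat (map (\<lambda>t. sorted_list_of_set (X \<inter> ball t r)) (sorted_list_of_set C)))"
    using assms(1) by simp
  moreover have "set (concat (map (\<lambda>t. sorted_list_of_set (X \<inter> ball t r)) (sorted_list_of_set C))) = X"
    using assms(1-3) by auto
  ultimately show ?thesis
    using assms(2) by (intro strict_sorted_equal) auto
qed


section \<open>Following the critical moments along a path of systems\<close>

lemma pathin_state:
  assumes "pathin (family_space n S \<D>) s" "u \<in> {0..1}" "t \<in> {0..1}"
  shows "s u t \<in> topspace (state_space n S)"
proof -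
  have "s u \<in> topspace (family_space n S \<D>)"
    using assms(1,2) continuous_map_image_subset_topspace by (fastforce simp: pathin_def)
  then have "continuous_map (top_of_set {0..1}) (state_space n S) (s u)"
    by (simp add: family_space_def system_space_def cont_maps_def)
  then show ?thesis
    using assms(3) continuous_map_image_subset_topspace by fastforce
qed

text \<open>
  Stability speaks of a neighbourhood in the space of systems. Pulling it back along the path gives
  continuity of the \<open>m\<close>-types in the parameter.
\<close>

lemma type_stable_near:
  assumes "pathin (family_space n S \<D>) s" "type_stable n k S \<D> P (s u0)" "u0 \<in> {0..1}"
  obtains T where "openin (top_of_set {0..1}) T" "u0 \<in> T"
    "\<And>m. m \<in> multiindices n k \<Longrightarrow> m_type_continuous P m (top_of_set T) s"
proof -
  let ?X = "family_space n S \<D>"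
  obtain U where U: "openin ?X U" "s u0 \<in> U"
    and cont: "\<And>m. m \<in> multiindices n k \<Longrightarrow>
        m_type_continuous P m (subtopology ?X U) (\<lambda>D'. D')"
    using assms(2) by (auto simp: type_stable_def)
  define T where "T = {u \<in> {0..1}. s u \<in> U}"
  have s: "continuous_map (top_of_set {0..1}) ?X s"
    using assms(1) by (simp add: pathin_def)
  have "openin (top_of_set {0..1}) T"
    using openin_continuous_map_preimage[OF s U(1)] by (simp add: T_def)
  moreover have "u0 \<in> T"
    using assms(3) U(2) by (simp add: T_def)
  moreover have "m_type_continuous P m (top_of_set T) s" if m: "m \<in> multiindices n k" for m
  proof -
    obtain l where l: "\<forall>D \<in> topspace (subtopology ?X U).
        finite (m_type P m D) \<and> card (m_type P m D) = l"
      "continuous_map (subtopology ?X U) (Euclidean_space l) (m_type_point P m)"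
      using cont[OF m] by (auto simp: m_type_continuous_def)
    have "continuous_map (top_of_set T) (subtopology ?X U) s"
      using continuous_map_from_subtopology[OF s, of T]
      by (auto simp: continuous_map_in_subtopology subtopology_subtopology T_def Int_absorb1
          subset_eq)
    then have "continuous_map (top_of_set T) (Euclidean_space l) (m_type_point P m \<circ> s)"
      "s ` T \<subseteq> topspace (subtopology ?X U)"
      using l(2) continuous_map_compose continuous_map_image_subset_topspace by fastforce+
    with l(1) show ?thesis
      unfolding m_type_continuous_def o_def by (intro exI[of _ l]) auto
  qed
  ultimately show ?thesis
    using that by blast
qed

lemma m_type_branch_self:
  assumes "finite (m_type P m (s u0))" "t \<in> m_type P m (s u0)"
  shows "m_type_branch P m s u0 t u0 = t"
  using nth_sorted_list_of_set_card_less[OF assms]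
  by (simp add: m_type_branch_def m_type_point_def)

text \<open>
  As the two \<open>m\<close>-types have the same size, pairing their increasing enumerations shows that every
  element of the second one lies on exactly one branch through an element of the first one.
\<close>

lemma m_type_branch_image:
  assumes "finite (m_type P m (s u0))" "finite (m_type P m (s u))"
    and "card (m_type P m (s u)) = card (m_type P m (s u0))"
  shows "m_type P m (s u) = (\<lambda>t. m_type_branch P m s u0 t u) ` m_type P m (s u0)"
proof (intro equalityI subsetI)
  fix x assume "x \<in> m_type P m (s u)"
  then obtain i where i: "i < card (m_type P m (s u0))" "x = sorted_list_of_set (m_type P m (s u)) ! i"
    using assms(2,3) by (metis in_set_conv_nth length_sorted_list_of_set set_sorted_list_of_set)
  define t where "t = sorted_list_of_set (m_type P m (s u0)) ! i"
  have "t \<in> m_type P m (s u0)"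
    using assms(1) i(1) unfolding t_def
    by (metis length_sorted_list_of_set nth_mem set_sorted_list_of_set)
  moreover have "x = m_type_branch P m s u0 t u"
    using card_less_nth_sorted_list_of_set[OF assms(1) i(1)] assms(3) i
    by (simp add: m_type_branch_def m_type_point_def t_def)
  ultimately show "x \<in> (\<lambda>t. m_type_branch P m s u0 t u) ` m_type P m (s u0)"
    by blast
next
  fix x assume "x \<in> (\<lambda>t. m_type_branch P m s u0 t u) ` m_type P m (s u0)"
  then obtain t where t: "t \<in> m_type P m (s u0)" "x = m_type_branch P m s u0 t u"
    by blast
  with nth_sorted_list_of_set_card_less(1)[OF assms(1) t(1)]
  show "x \<in> m_type P m (s u)"
    using assms(2,3) nth_mem[of _ "sorted_list_of_set (m_type P m (s u))"]
    by (simp add: m_type_branch_def m_type_point_def)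
qed

lemma m_type_continuous_branch:
  assumes "m_type_continuous P m (top_of_set T) s" "u0 \<in> T"
  shows "finite (m_type P m (s u0))"
    and "\<And>u. u \<in> T \<Longrightarrow> m_type P m (s u) = (\<lambda>t. m_type_branch P m s u0 t u) ` m_type P m (s u0)"
    and "\<And>t. continuous_on T (m_type_branch P m s u0 t)"
proof -
  obtain l where l: "\<And>u. u \<in> T \<Longrightarrow> finite (m_type P m (s u))"
      "\<And>u. u \<in> T \<Longrightarrow> card (m_type P m (s u)) = l"
    and cont: "continuous_map (top_of_set T) (Euclidean_space l) (\<lambda>u. m_type_point P m (s u))"
    using assms(1) by (auto simp: m_type_continuous_def)
  show "finite (m_type P m (s u0))"
    using l assms(2) by blast
  show "m_type P m (s u) = (\<lambda>t. m_type_branch P m s u0 t u) ` m_type P m (s u0)" if "u \<in> T" for u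
    using l that assms(2) by (intro m_type_branch_image) auto
  have "continuous_on T (\<lambda>u. m_type_point P m (s u) i)" for i
    using cont by (auto simp: Euclidean_space_def continuous_map_in_subtopology
        continuous_map_componentwise_UNIV)
  then show "continuous_on T (m_type_branch P m s u0 t)" for t
    by (simp add: m_type_branch_def)
qed

text \<open>
  At the parameter \<open>u\<close>, the branches through the critical moments at \<open>u0\<close> exhaust all critical moments,
  and no branch has moved by \<open>r\<close> or more. If the critical moments at \<open>u0\<close> are far enough apart, the type
  of \<open>s u\<close> can then be read off from the branches.
\<close>

definition tracked ::
    "nat \<Rightarrow> nat \<Rightarrow> 'a property \<Rightarrow> (real \<Rightarrow> 'a system) \<Rightarrow> real \<Rightarrow> real \<Rightarrow> real \<Rightarrow> bool" where
  "tracked n k P s u0 r u \<longleftrightarrow> (\<forall>m \<in> multiindices n k.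
     m_type P m (s u) = (\<lambda>t. m_type_branch P m s u0 t u) ` m_type P m (s u0) \<and>
     (\<forall>t \<in> m_type P m (s u0). \<bar>m_type_branch P m s u0 t u - t\<bar> < r))"

lemma type_stable_tracked:
  assumes "pathin (family_space n S \<D>) s" "type_stable n k S \<D> P (s u0)" "u0 \<in> {0..1}"
  shows "\<And>m. m \<in> multiindices n k \<Longrightarrow> finite (m_type P m (s u0))"
    and "0 < r \<Longrightarrow> tracked n k P s u0 r u0"
    and "0 < r \<Longrightarrow> eventually (tracked n k P s u0 r) (at u0 within {0..1})"
proof -
  obtain T where T: "openin (top_of_set {0..1}) T" "u0 \<in> T"
    "\<And>m. m \<in> multiindices n k \<Longrightarrow> m_type_continuous P m (top_of_set T) s"
    using type_stable_near[OF assms] by metis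
  note branch = m_type_continuous_branch[OF T(3) T(2)]
  show fin: "finite (m_type P m (s u0))" if "m \<in> multiindices n k" for m
    using branch(1) that .
  show "tracked n k P s u0 r u0" if "0 < r"
    using fin that by (auto simp: tracked_def m_type_branch_self)
  have at: "at u0 within {0..1} = at u0 within T"
  proof -
    obtain V where "open V" "T = {0..1} \<inter> V"
      using T(1) by (auto simp: openin_open)
    with T(2) show ?thesis
      by (intro at_within_nhd[of u0 V]) auto
  qed
  have "eventually (\<lambda>u. \<bar>m_type_branch P m s u0 t u - t\<bar> < r) (at u0 within {0..1})"
    if "0 < r" "m \<in> multiindices n k" "t \<in> m_type P m (s u0)" for m t
  proof -
    have "(m_type_branch P m s u0 t \<longlongrightarrow> m_type_branch P m s u0 t u0) (at u0 within T)"
      using branch(3)[OF that(2)] T(2) by (auto simp: continuous_on_def)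
    then have "(m_type_branch P m s u0 t \<longlongrightarrow> t) (at u0 within {0..1})"
      using m_type_branch_self[of P m s u0 t] fin[OF that(2)] that(3) at by simp
    from tendstoD[OF this that(1)] show ?thesis
      by (simp add: dist_real_def)
  qed
  moreover have "eventually (\<lambda>u. u \<in> T) (at u0 within {0..1})"
    unfolding at by (simp add: eventually_at_filter)
  then have "eventually (\<lambda>u. m_type P m (s u) =
      (\<lambda>t. m_type_branch P m s u0 t u) ` m_type P m (s u0)) (at u0 within {0..1})"
    if "m \<in> multiindices n k" for m
    by (rule eventually_mono) (rule branch(2)[OF that])
  ultimately show "eventually (tracked n k P s u0 r) (at u0 within {0..1})" if "0 < r"
    using that fin unfolding tracked_def
    by (intro eventually_ball_finite ballI eventually_conj finite_multiindices) auto
qed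


section \<open>The word spelled by the critical moments near a given moment\<close>

lemma trackedE:
  assumes "tracked n k P s u0 r u" "m \<in> multiindices n k" "x \<in> m_type P m (s u)"
  obtains t where "t \<in> m_type P m (s u0)" "x = m_type_branch P m s u0 t u" "\<bar>x - t\<bar> < r"
proof -
  have "m_type P m (s u) = (\<lambda>t. m_type_branch P m s u0 t u) ` m_type P m (s u0)"
    "\<forall>t \<in> m_type P m (s u0). \<bar>m_type_branch P m s u0 t u - t\<bar> < r"
    using assms(1,2) by (simp_all add: tracked_def)
  with assms(3) that show ?thesis
    by auto
qed

definition cluster_word :: "nat \<Rightarrow> nat \<Rightarrow> 'a property \<Rightarrow> 'a system \<Rightarrow> real set \<Rightarrow> nat set list" where
  "cluster_word n k P D X =
     map (\<lambda>t. THE m. m \<in> multiindices n k \<and> P (D t) m)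
       (sorted_list_of_set (critical_moments n k P D \<inter> X))"

lemma critical_moments_eq_m_types:
  "critical_moments n k P D = (\<Union>m \<in> multiindices n k. m_type P m D)"
  by (auto simp: critical_moments_def m_type_def)

text \<open>
  A critical moment of \<open>s u\<close> in the ball around \<open>t\<close> lies on a branch that starts within \<open>r\<close> of it; by
  the separation of the critical moments of \<open>s u0\<close> this branch starts at \<open>t\<close>. So the letters near \<open>t\<close>
  are the multiindices with the property at \<open>t\<close>, one for each branch through \<open>t\<close>.
\<close>

lemma cluster_word_letters:
  assumes "pleasant n k P (s u)" "tracked n k P s u0 r u"
    and t: "t \<in> critical_moments n k P (s u0)"
    and sep: "\<forall>t\<in>critical_moments n k P (s u0). \<forall>t'\<in>critical_moments n k P (s u0). t \<noteq> t' \<longrightarrow> 2 * r \<le> \<bar>t - t'\<bar>"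
  shows "set (cluster_word n k P (s u) (ball t r)) = {m \<in> multiindices n k. P (s u0 t) m}"
    and "sorted_wrt (\<lambda>a b. m_type_branch P a s u0 t u < m_type_branch P b s u0 t u)
           (cluster_word n k P (s u) (ball t r))"
proof -
  define X where "X = critical_moments n k P (s u) \<inter> ball t r"
  define Q where "Q x = (THE m. m \<in> multiindices n k \<and> P (s u x) m)" for x
  have word: "cluster_word n k P (s u) (ball t r) = map Q (sorted_list_of_set X)"
    by (simp add: cluster_word_def X_def Q_def)
  have fin: "finite X"
    using assms(1) by (simp add: X_def pleasant_def)
  have Q: "Q x \<in> multiindices n k \<and> P (s u x) (Q x)" if "x \<in> X" for x
    using that assms(1) theI'[of "\<lambda>m. m \<in> multiindices n k \<and> P (s u x) m"]
    by (simp add: X_def Q_def pleasant_def)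
  have on_branch: "P (s u0 t) (Q x) \<and> x = m_type_branch P (Q x) s u0 t u" if x: "x \<in> X" for x
  proof -
    have "x \<in> m_type P (Q x) (s u)"
      using Q[OF x] x by (simp add: m_type_def X_def critical_moments_def)
    then obtain t' where t': "t' \<in> m_type P (Q x) (s u0)" "x = m_type_branch P (Q x) s u0 t' u"
      "\<bar>x - t'\<bar> < r"
      using trackedE[OF assms(2)] Q[OF x] by metis
    moreover have "t' \<in> critical_moments n k P (s u0)"
      using t'(1) Q[OF x] by (auto simp: critical_moments_eq_m_types)
    moreover have "\<bar>t - x\<bar> < r"
      using x by (simp add: X_def dist_real_def)
    ultimately have "t' = t"
      using sep t by force
    with t' show ?thesis
      by (simp add: m_type_def)
  qed
  have "m \<in> Q ` X" if "m \<in> multiindices n k" "P (s u0 t) m" for m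
  proof -
    define x where "x = m_type_branch P m s u0 t u"
    have "t \<in> m_type P m (s u0)"
      using that t by (simp add: m_type_def critical_moments_def)
    then have x: "x \<in> m_type P m (s u)" "\<bar>x - t\<bar> < r"
      using that(1) assms(2) by (auto simp: tracked_def x_def)
    then have "x \<in> X"
      using that(1) by (auto simp: X_def critical_moments_eq_m_types dist_real_def)
    moreover have "P (s u x) m"
      using x(1) by (simp add: m_type_def)
    then have "Q x = m"
      using Q[OF \<open>x \<in> X\<close>] that(1) \<open>x \<in> X\<close> assms(1) by (auto simp: X_def pleasant_def)
    ultimately show ?thesis
      by blast
  qed
  then show "set (cluster_word n k P (s u) (ball t r)) = {m \<in> multiindices n k. P (s u0 t) m}"
    using Q on_branch fin unfolding word by auto
  have "sorted_wrt (\<lambda>x y. m_type_branch P (Q x) s u0 t u < m_type_branch P (Q y) s u0 t u)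
      (sorted_list_of_set X)"
  proof (rule sorted_wrt_mono_rel[OF _ sorted_list_of_set.strict_sorted_key_list_of_set])
    fix x y assume "x \<in> set (sorted_list_of_set X)" "y \<in> set (sorted_list_of_set X)" "x < y"
    then show "m_type_branch P (Q x) s u0 t u < m_type_branch P (Q y) s u0 t u"
      using on_branch fin by auto
  qed
  then show "sorted_wrt (\<lambda>a b. m_type_branch P a s u0 t u < m_type_branch P b s u0 t u)
      (cluster_word n k P (s u) (ball t r))"
    by (simp add: word sorted_wrt_map)
qed

lemma system_type_clusters:
  assumes "pleasant n k P (s u)" "tracked n k P s u0 r u" "finite (critical_moments n k P (s u0))"
    and "\<forall>t\<in>critical_moments n k P (s u0). \<forall>t'\<in>critical_moments n k P (s u0). t \<noteq> t' \<longrightarrow> 2 * r \<le> \<bar>t - t'\<bar>"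
  shows "system_type n k P (s u) =
    concat (map (\<lambda>t. cluster_word n k P (s u) (ball t r))
      (sorted_list_of_set (critical_moments n k P (s u0))))"
proof -
  let ?C = "critical_moments n k P (s u0)" and ?X = "critical_moments n k P (s u)"
  have "?X \<subseteq> (\<Union>t\<in>?C. ball t r)"
  proof
    fix x assume "x \<in> ?X"
    then obtain m where m: "m \<in> multiindices n k" "x \<in> m_type P m (s u)"
      by (auto simp: critical_moments_eq_m_types)
    then obtain t where "t \<in> m_type P m (s u0)" "\<bar>x - t\<bar> < r"
      using trackedE[OF assms(2)] by metis
    with m(1) have "t \<in> ?C" "x \<in> ball t r"
      by (auto simp: critical_moments_eq_m_types dist_real_def)
    then show "x \<in> (\<Union>t\<in>?C. ball t r)"
      by blast
  qed
  with assms have "sorted_list_of_set ?X =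
      concat (map (\<lambda>t. sorted_list_of_set (?X \<inter> ball t r)) (sorted_list_of_set ?C))"
    by (intro sorted_list_of_set_clusters) (auto simp: pleasant_def)
  then show ?thesis
    by (simp add: system_type_def cluster_word_def map_concat o_def)
qed

text \<open>
  The extra element \<open>1\<close> of the minimum covers the sets \<open>C\<close> with fewer than two elements.
\<close>

lemma finite_real_separation:
  fixes C :: "real set"
  assumes "finite C"
  obtains r where "0 < r" "\<forall>t\<in>C. \<forall>t'\<in>C. t \<noteq> t' \<longrightarrow> 2 * r \<le> \<bar>t - t'\<bar>"
proof -
  let ?d = "(\<lambda>(t, t'). \<bar>t - t'\<bar> / 2) ` {(t, t') \<in> C \<times> C. t \<noteq> t'}"
  have fin: "finite (insert 1 ?d)"
    by (intro finite.insertI finite_imageI finite_subset[OF _ finite_cartesian_product[OF assms assms]])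
       auto
  show ?thesis
  proof
    show "0 < Min (insert 1 ?d)"
      using fin by (subst Min_gr_iff) auto
    show "\<forall>t\<in>C. \<forall>t'\<in>C. t \<noteq> t' \<longrightarrow> 2 * Min (insert 1 ?d) \<le> \<bar>t - t'\<bar>"
    proof (intro ballI impI)
      fix t t' assume that: "t \<in> C" "t' \<in> C" "t \<noteq> t'"
      have "\<bar>t - t'\<bar> / 2 \<in> insert 1 ?d"
        using that by force
      then have "Min (insert 1 ?d) \<le> \<bar>t - t'\<bar> / 2"
        using fin by (rule Min_le[rotated])
      then show "2 * Min (insert 1 ?d) \<le> \<bar>t - t'\<bar>" by simp
    qed
  qed
qed

text \<open>
  Types of nearby systems are compared cluster by cluster. A cluster that starts from a moment with
  one multiindex is a single letter, which leaves the multiple moments. Those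
  make \<open>s u0\<close> not pleasant, so there the parameters to be compared differ from \<open>u0\<close>.
  The predicate \<open>E\<close> lets an event restrict the neighbourhood further.
\<close>

lemma braid_eq_near_type_stable:
  assumes path: "pathin (family_space n S \<D>) s" and stable: "type_stable n k S \<D> P (s u0)"
    and u0: "u0 \<in> {0..1}" and E: "eventually E (at u0 within {0..1})"
    and multiple: "\<And>t u u' w w'. t \<in> multiple_moments n k P (s u0) \<Longrightarrow>
      u \<noteq> u0 \<Longrightarrow> u' \<noteq> u0 \<Longrightarrow> E u \<Longrightarrow> E u' \<Longrightarrow>
      set w = {m \<in> multiindices n k. P (s u0 t) m} \<Longrightarrow>
      set w' = {m \<in> multiindices n k. P (s u0 t) m} \<Longrightarrow>
      sorted_wrt (\<lambda>a b. m_type_branch P a s u0 t u < m_type_branch P b s u0 t u) w \<Longrightarrow>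
      sorted_wrt (\<lambda>a b. m_type_branch P a s u0 t u' < m_type_branch P b s u0 t u') w' \<Longrightarrow>
      braid_eq n k w w'"
  obtains V where "open V" "u0 \<in> V"
    "\<And>u u'. u \<in> V \<inter> {0..1} \<Longrightarrow> u' \<in> V \<inter> {0..1} \<Longrightarrow> pleasant n k P (s u) \<Longrightarrow> pleasant n k P (s u') \<Longrightarrow>
       braid_eq n k (system_type n k P (s u)) (system_type n k P (s u'))"
proof -
  let ?C = "critical_moments n k P (s u0)"
  have fin: "finite ?C"
    using type_stable_tracked(1)[OF path stable u0]
    by (simp add: critical_moments_eq_m_types finite_multiindices)
  obtain r where r: "0 < r" and sep: "\<forall>t\<in>?C. \<forall>t'\<in>?C. t \<noteq> t' \<longrightarrow> 2 * r \<le> \<bar>t - t'\<bar>"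
    using finite_real_separation[OF fin] by metis
  have "eventually (\<lambda>u. tracked n k P s u0 r u \<and> E u) (at u0 within {0..1})"
    using type_stable_tracked(3)[OF path stable u0 r] E by (rule eventually_conj)
  then obtain V where V: "open V" "u0 \<in> V"
    "\<And>u. u \<in> V \<Longrightarrow> u \<noteq> u0 \<Longrightarrow> u \<in> {0..1} \<Longrightarrow> tracked n k P s u0 r u \<and> E u"
    by (auto simp: eventually_at_topological)
  have "braid_eq n k (system_type n k P (s u)) (system_type n k P (s u'))"
    if u: "u \<in> V \<inter> {0..1}" "pleasant n k P (s u)" and u': "u' \<in> V \<inter> {0..1}" "pleasant n k P (s u')"
    for u u'
  proof -
    have tracked: "tracked n k P s u0 r u" "tracked n k P s u0 r u'"
      using V(3) u u' type_stable_tracked(2)[OF path stable u0 r] by blast+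
    have "braid_eq n k (cluster_word n k P (s u) (ball t r)) (cluster_word n k P (s u') (ball t r))"
      if t: "t \<in> ?C" for t
    proof -
      note w = cluster_word_letters[OF u(2) tracked(1) t sep]
        and w' = cluster_word_letters[OF u'(2) tracked(2) t sep]
      show ?thesis
      proof (cases "t \<in> multiple_moments n k P (s u0)")
        case True
        then have "\<not> pleasant n k P (s u0)"
          by (auto simp: multiple_moments_def pleasant_def)
        then have "u \<noteq> u0" "u' \<noteq> u0"
          using u u' by auto
        with True V(3) u u' w w' show ?thesis
          by (intro multiple[of t u u']) auto
      next
        case False
        then have "\<exists>!m. m \<in> multiindices n k \<and> P (s u0 t) m"
          using t by (auto simp: multiple_moments_def)
        then show ?thesis
          using w w' by (intro braid_eq_far_permutation) (auto dest: sorted_wrt_key_distinct)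
      qed
    qed
    then show ?thesis
      unfolding system_type_clusters[OF u(2) tracked(1) fin sep]
        system_type_clusters[OF u'(2) tracked(2) fin sep]
      using fin by (intro braid_eq_concat) simp
  qed
  with V that show ?thesis
    by blast
qed


section \<open>Multiple moments of a good property\<close>

lemma k_good_subset:
  assumes "k_good n k S P" "x \<in> topspace (state_space n S)" "A \<subseteq> {1..n}" "B \<subseteq> A" "P x A"
  shows "P x B"
  using assms(1)[unfolded k_good_def, THEN bspec, OF assms(2), THEN conjunct1,
      THEN spec[of _ A], THEN spec[of _ B]] assms(3-5) by simp

text \<open>
  The third clause of goodness speaks of sequences of \<open>k + 1\<close> indices. Enumerating \<open>A \<union> B\<close> so that
  the index missing from \<open>B\<close> comes first and the one missing from \<open>A\<close> comes last turns it
  into a statement about sets.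
\<close>

lemma k_good_union:
  assumes "k_good n k S P" "x \<in> topspace (state_space n S)" "0 < k"
    and A: "A \<in> multiindices n k" "P x A" and B: "B \<in> multiindices n k" "P x B"
    and AB: "A \<noteq> B" "card (A \<inter> B) = k - 1"
  shows "A \<union> B \<in> multiindices n (k + 1)" "P x (A \<union> B)"
proof -
  have fin: "finite A" "finite B" and card: "card A = k" "card B = k"
    and sub: "A \<subseteq> {1..n}" "B \<subseteq> {1..n}"
    using finite_multiindex[OF A(1)] finite_multiindex[OF B(1)] A(1) B(1)
    by (auto simp: multiindices_def)
  have "card (A - B) = 1" "card (B - A) = 1"
    using card_Diff_subset_Int[of A B] card_Diff_subset_Int[of B A] fin card AB(2) \<open>0 < k\<close>
    by (simp_all add: Int_commute)
  then obtain a b where ab: "A - B = {a}" "B - A = {b}"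
    by (metis card_1_singletonE)
  have "card {2..k} = card (A \<inter> B)"
    using AB(2) by simp
  then obtain h where h: "bij_betw h {2..k} (A \<inter> B)"
    using finite_same_card_bij[of "{2..k}" "A \<inter> B"] fin by auto
  define i where "i j = (if j = 1 then a else if j = k + 1 then b else h j)" for j
  have "i ` {2..k} = h ` {2..k}"
    by (intro image_cong) (auto simp: i_def)
  then have mid: "i ` {2..k} = A \<inter> B"
    using h by (simp add: bij_betw_def)
  have intervals: "{1..k} = insert 1 {2..k}" "{2..k+1} = insert (k+1) {2..k}"
    "{1..k+1} = insert 1 (insert (k+1) {2..k})"
    using \<open>0 < k\<close> by auto
  have ends: "i 1 = a" "i (k+1) = b"
    using \<open>0 < k\<close> by (auto simp: i_def)
  have images: "i ` {1..k} = A" "i ` {2..k+1} = B" "i ` {1..k+1} = A \<union> B"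
    unfolding intervals image_insert ends mid using ab by auto
  have card_union: "card (A \<union> B) = k + 1"
    using card_Un_Int[OF fin] card AB(2) \<open>0 < k\<close> by simp
  then have "inj_on i {1..k+1}"
    by (intro eq_card_imp_inj_on) (simp_all only: images(3) card_atLeastAtMost finite_atLeastAtMost
        add_diff_cancel_right')
  moreover have "A \<union> B \<subseteq> {1..n}"
    using sub by blast
  ultimately show "P x (A \<union> B)"
    using assms(1)[unfolded k_good_def, THEN bspec, OF assms(2), THEN conjunct2, THEN conjunct2,
        THEN spec[of _ i], unfolded images] A(2) B(2) by blast
  show "A \<union> B \<in> multiindices n (k + 1)"
    using card_union sub by (simp add: multiindices_def)
qed

text \<open>
  If \<open>A\<close> and \<open>B\<close> shared \<open>k - 1\<close> elements, their union would be a \<open>(k+1)\<close>-element set with the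
  property, hence equal to \<open>m\<close>, and both would be faces of \<open>m\<close>.
\<close>

lemma far_from_simplex:
  assumes "k_good n k S P" "x \<in> topspace (state_space n S)" "0 < k"
    and unique: "{m' \<in> multiindices n (k+1). P x m'} = {m}"
    and A: "A \<in> multiindices n k" "P x A" and B: "B \<in> multiindices n k" "P x B"
    and "A \<noteq> B" "\<not> (A \<subseteq> m \<and> B \<subseteq> m)"
  shows "card (A \<inter> B) < k - 1"
proof -
  have fin: "finite A" "finite B" "card A = k" "card B = k"
    using finite_multiindex[OF A(1)] finite_multiindex[OF B(1)] A(1) B(1)
    by (auto simp: multiindices_def)
  then have "A \<inter> B \<subset> A"
    using \<open>A \<noteq> B\<close> card_subset_eq[of B A] by auto
  then have "card (A \<inter> B) < k"
    using fin psubset_card_mono by blast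
  moreover have "card (A \<inter> B) \<noteq> k - 1"
  proof
    assume "card (A \<inter> B) = k - 1"
    then have "A \<union> B \<in> {m' \<in> multiindices n (k+1). P x m'}"
      using k_good_union[OF assms(1-3) A B \<open>A \<noteq> B\<close>] by simp
    then show False
      using unique \<open>\<not> (A \<subseteq> m \<and> B \<subseteq> m)\<close> by auto
  qed
  ultimately show ?thesis
    by simp
qed

text \<open>
  Both words list the faces of \<open>m\<close> in one of two opposite orders, which the tetrahedron relation
  identifies.
\<close>

lemma braid_eq_simplex_swap:
  assumes "finite m" "card m = k + 1" "m \<subseteq> {1..n}" "distinct us" "set us = m"
    and "v = map (\<lambda>j. m - {j}) us \<or> v = rev (map (\<lambda>j. m - {j}) us)"
    and "v' = map (\<lambda>j. m - {j}) us \<or> v' = rev (map (\<lambda>j. m - {j}) us)"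
  shows "braid_eq n k v v'"
proof -
  let ?V = "map (\<lambda>j. m - {j}) us"
  have "length us = k + 1"
    using assms(2,4,5) by (metis distinct_card)
  then have swap: "braid_eq n k ?V (rev ?V)"
    using braid_eq_tetrahedron[of us k n] assms(3-5) by simp
  have "set ?V \<subseteq> multiindices n k"
    using assms(1-3,5) by (auto simp: multiindices_def)
  then have "braid_eq n k ?V ?V" "braid_eq n k (rev ?V) (rev ?V)"
    by (simp_all only: braid_eq_refl set_rev)
  with swap braid_eq_sym[OF swap] assms(6,7) show ?thesis
    by auto
qed

text \<open>
  The difference quotient of \<open>g - f\<close> at the common value tends to a positive limit, so near \<open>u0\<close> the
  difference \<open>g u - f u\<close> has the sign of \<open>u - u0\<close>.
\<close>

lemma eventually_ordered_by_deriv: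
  fixes f g :: "real \<Rightarrow> real"
  assumes "f differentiable at u0" "g differentiable at u0" "f u0 = g u0" "deriv f u0 < deriv g u0"
  shows "eventually (\<lambda>u. (u0 < u \<longrightarrow> f u < g u) \<and> (u < u0 \<longrightarrow> g u < f u)) (at u0 within A)"
proof -
  have "((\<lambda>u. g u - f u) has_field_derivative deriv g u0 - deriv f u0) (at u0 within A)"
    using assms(1,2)
    by (intro DERIV_subset[OF DERIV_diff, of _ _ _ UNIV])
       (simp_all add: DERIV_deriv_iff_real_differentiable)
  then have "((\<lambda>u. (g u - f u) / (u - u0)) \<longlongrightarrow> deriv g u0 - deriv f u0) (at u0 within A)"
    using assms(3) by (simp add: has_field_derivative_iff)
  then have "eventually (\<lambda>u. 0 < (g u - f u) / (u - u0)) (at u0 within A)"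
    by (rule order_tendstoD) (use assms(4) in simp)
  then show ?thesis
    by (rule eventually_mono) (auto simp: zero_less_divide_iff)
qed

text \<open>
  The letters at the multiple moment are the faces of \<open>m\<close> and letters far from everything else. After
  the latter have been moved to the front, the faces are left in the order of their velocities for
  \<open>u > u0\<close> and in the opposite order for \<open>u < u0\<close>.
\<close>

lemma simplex_event_braid_eq:
  assumes good: "k_good n k S P" "0 < k"
    and path: "pathin (family_space n S \<D>) s" and stable: "type_stable n k S \<D> P (s u0)"
    and u0: "u0 \<in> {0..1}" and event: "simplex_event n k P s u0"
  obtains V where "open V" "u0 \<in> V"
    "\<And>u u'. u \<in> V \<inter> {0..1} \<Longrightarrow> u' \<in> V \<inter> {0..1} \<Longrightarrow> pleasant n k P (s u) \<Longrightarrow> pleasant n k P (s u') \<Longrightarrow>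
       braid_eq n k (system_type n k P (s u)) (system_type n k P (s u'))"
proof -
  obtain t0 m \<epsilon> where multiple: "multiple_moments n k P (s u0) = {t0}"
    and m: "{m' \<in> multiindices n (k+1). P (s u0 t0) m'} = {m}"
    and \<epsilon>: "0 < \<epsilon>" and smooth: "\<And>j. j \<in> m \<Longrightarrow>
      smooth_on_interval {u0-\<epsilon><..<u0+\<epsilon>} (m_type_branch P (m - {j}) s u0 t0)"
    and inj: "inj_on (\<lambda>j. deriv (m_type_branch P (m - {j}) s u0 t0) u0) m"
    using event unfolding simplex_event_def by auto
  define y where "y a = m_type_branch P a s u0 t0" for a
  have t0: "t0 \<in> {0..1}"
    using multiple by (auto simp: multiple_moments_def critical_moments_def)
  have state: "s u0 t0 \<in> topspace (state_space n S)"
    using pathin_state[OF path u0 t0] .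
  have m_index: "m \<in> multiindices n (k + 1)" and "P (s u0 t0) m"
    using singletonI[of m, folded m] by (simp_all only: mem_Collect_eq)
  then have mm: "m \<subseteq> {1..n}" "card m = k + 1" "finite m" "P (s u0 t0) m"
    using finite_multiindex[OF m_index] by (auto simp: multiindices_def)
  have face: "m - {j} \<in> multiindices n k" "P (s u0 t0) (m - {j})" if "j \<in> m" for j
  proof -
    show "m - {j} \<in> multiindices n k"
      using mm that by (auto simp: multiindices_def)
    show "P (s u0 t0) (m - {j})"
      by (rule k_good_subset[OF good(1) state mm(1) _ mm(4)]) blast
  qed
  have face_iff: "a \<subseteq> m \<longleftrightarrow> (\<exists>j\<in>m. a = m - {j})" if "a \<in> multiindices n k" for a
  proof
    assume "a \<subseteq> m"
    moreover have "card a = k" "finite a"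
      using that finite_multiindex[OF that] by (auto simp: multiindices_def)
    ultimately have "card (m - a) = 1"
      using mm(2) by (simp add: card_Diff_subset)
    then obtain j where "m - a = {j}"
      by (metis card_1_singletonE)
    then show "\<exists>j\<in>m. a = m - {j}"
      using \<open>a \<subseteq> m\<close> by (intro bexI[of _ j]) auto
  qed auto
  have diff: "y (m - {j}) differentiable at u0" if "j \<in> m" for j
    using smooth[OF that] \<epsilon> unfolding smooth_on_interval_def y_def
    by (auto dest: spec[of _ 0])
  have y0: "y (m - {j}) u0 = t0" if "j \<in> m" for j
  proof -
    have "finite (m_type P (m - {j}) (s u0))"
      using type_stable_tracked(1)[OF path stable u0 face(1)[OF that]] .
    then show ?thesis
      using face[OF that] t0 by (simp add: y_def m_type_branch_self m_type_def)
  qed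
  define d where "d j = deriv (y (m - {j})) u0" for j
  \<comment> \<open>The indices sorted by the velocity of the opposite face.\<close>
  obtain us where us: "set us = m" "sorted_wrt (\<lambda>i j. d i < d j) us"
    using sorted_wrt_key_exists[OF mm(3), of d] inj unfolding d_def y_def by metis
  define E where "E u \<longleftrightarrow> (\<forall>i\<in>m. \<forall>j\<in>m. d i < d j \<longrightarrow>
      (u0 < u \<longrightarrow> y (m - {i}) u < y (m - {j}) u) \<and> (u < u0 \<longrightarrow> y (m - {j}) u < y (m - {i}) u))" for u
  have E: "eventually E (at u0 within {0..1})"
  proof -
    have "eventually (\<lambda>u. d i < d j \<longrightarrow> (u0 < u \<longrightarrow> y (m - {i}) u < y (m - {j}) u) \<and>
        (u < u0 \<longrightarrow> y (m - {j}) u < y (m - {i}) u)) (at u0 within {0..1})"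
      if "i \<in> m" "j \<in> m" for i j
    proof (cases "d i < d j")
      case True
      then show ?thesis
        using eventually_ordered_by_deriv[OF diff[OF that(1)] diff[OF that(2)]] y0 that
        by (simp add: d_def)
    qed simp
    then show ?thesis
      unfolding E_def by (intro eventually_ball_finite ballI mm(3)) auto
  qed
  have order: "filter (\<lambda>a. a \<subseteq> m) w = map (\<lambda>j. m - {j}) us \<or>
      filter (\<lambda>a. a \<subseteq> m) w = rev (map (\<lambda>j. m - {j}) us)"
    if "E u" "u \<noteq> u0" "set w = {a \<in> multiindices n k. P (s u0 t0) a}"
      "sorted_wrt (\<lambda>a b. y a u < y b u) w" for u w
  proof -
    have set: "set (filter (\<lambda>a. a \<subseteq> m) w) = (\<lambda>j. m - {j}) ` m"
      using that(3) face face_iff by auto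
    have sorted: "sorted_wrt (\<lambda>a b. y a u < y b u) (filter (\<lambda>a. a \<subseteq> m) w)"
      using that(4) by (rule sorted_wrt_filter)
    from that(2) consider "u0 < u" | "u < u0"
      by linarith
    then show ?thesis
    proof cases
      case 1
      have "sorted_wrt (\<lambda>i j. y (m - {i}) u < y (m - {j}) u) us"
        by (rule sorted_wrt_mono_rel[OF _ us(2)]) (use 1 that(1) us(1) in \<open>auto simp: E_def\<close>)
      then have "filter (\<lambda>a. a \<subseteq> m) w = map (\<lambda>j. m - {j}) us"
        using set us(1) by (intro sorted_wrt_key_unique[OF sorted]) (auto simp: sorted_wrt_map)
      then show ?thesis ..
    next
      case 2
      have "sorted_wrt (\<lambda>i j. y (m - {j}) u < y (m - {i}) u) us"
        by (rule sorted_wrt_mono_rel[OF _ us(2)]) (use 2 that(1) us(1) in \<open>auto simp: E_def\<close>)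
      then have "filter (\<lambda>a. a \<subseteq> m) w = rev (map (\<lambda>j. m - {j}) us)"
        using set us(1)
        by (intro sorted_wrt_key_unique[OF sorted]) (auto simp: sorted_wrt_map sorted_wrt_rev)
      then show ?thesis ..
    qed
  qed
  have far: "card (a \<inter> b) < k - 1"
    if "a \<in> multiindices n k" "P (s u0 t0) a" "b \<in> multiindices n k" "P (s u0 t0) b"
      "a \<noteq> b" "\<not> (a \<subseteq> m \<and> b \<subseteq> m)" for a b
    using far_from_simplex[OF good(1) state good(2) m that] .
  have normal: "braid_eq n k w (filter (\<lambda>a. \<not> a \<subseteq> m) w @ filter (\<lambda>a. a \<subseteq> m) w)"
    if "set w = {a \<in> multiindices n k. P (s u0 t0) a}" for w
    using braid_eq_partition[of w n k "\<lambda>a. \<not> a \<subseteq> m"] far that by auto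
  show thesis
  proof (rule braid_eq_near_type_stable[OF path stable u0 E])
    fix t u u' w w'
    assume t: "t \<in> multiple_moments n k P (s u0)" and u: "u \<noteq> u0" "u' \<noteq> u0" "E u" "E u'"
      and w: "set w = {m \<in> multiindices n k. P (s u0 t) m}"
        "set w' = {m \<in> multiindices n k. P (s u0 t) m}"
      and sorted: "sorted_wrt (\<lambda>a b. m_type_branch P a s u0 t u < m_type_branch P b s u0 t u) w"
        "sorted_wrt (\<lambda>a b. m_type_branch P a s u0 t u' < m_type_branch P b s u0 t u') w'"
    have "t = t0"
      using t multiple by simp
    note w = w[unfolded this] and sorted = sorted[unfolded this, folded y_def]
    have "braid_eq n k (filter (\<lambda>a. \<not> a \<subseteq> m) w) (filter (\<lambda>a. \<not> a \<subseteq> m) w')"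
      using sorted[THEN sorted_wrt_key_distinct] w far by (intro braid_eq_far_permutation) auto
    moreover have "braid_eq n k (filter (\<lambda>a. a \<subseteq> m) w) (filter (\<lambda>a. a \<subseteq> m) w')"
      using mm order[OF u(3,1) w(1) sorted(1)] order[OF u(4,2) w(2) sorted(2)]
        sorted_wrt_key_distinct[OF us(2)] us(1)
      by (intro braid_eq_simplex_swap)
    ultimately have "braid_eq n k (filter (\<lambda>a. \<not> a \<subseteq> m) w @ filter (\<lambda>a. a \<subseteq> m) w)
        (filter (\<lambda>a. \<not> a \<subseteq> m) w' @ filter (\<lambda>a. a \<subseteq> m) w')"
      by (rule braid_eq_append)
    then show "braid_eq n k w w'"
      using normal[OF w(1)] braid_eq_sym[OF normal[OF w(2)]] by (blast intro: braid_eq_trans)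
  qed (use that in blast)
qed

lemma far_event_braid_eq:
  assumes path: "pathin (family_space n S \<D>) s" and stable: "type_stable n k S \<D> P (s u0)"
    and u0: "u0 \<in> {0..1}" and event: "far_event n k P s u0"
  obtains V where "open V" "u0 \<in> V"
    "\<And>u u'. u \<in> V \<inter> {0..1} \<Longrightarrow> u' \<in> V \<inter> {0..1} \<Longrightarrow> pleasant n k P (s u) \<Longrightarrow> pleasant n k P (s u') \<Longrightarrow>
       braid_eq n k (system_type n k P (s u)) (system_type n k P (s u'))"
proof -
  obtain t0 m m' where multiple: "multiple_moments n k P (s u0) = {t0}"
    and letters: "{\<mu> \<in> multiindices n k. P (s u0 t0) \<mu>} = {m, m'}"
    and far: "card (m \<inter> m') < k - 1"
    using event unfolding far_event_def by auto
  have sub: "{m, m'} \<subseteq> multiindices n k"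
    unfolding letters[symmetric] by blast
  show thesis
  proof (rule braid_eq_near_type_stable[OF path stable u0 eventually_True])
    fix t u u' w w'
    assume t: "t \<in> multiple_moments n k P (s u0)"
      and w: "set w = {m \<in> multiindices n k. P (s u0 t) m}"
        "set w' = {m \<in> multiindices n k. P (s u0 t) m}"
      and sorted: "sorted_wrt (\<lambda>a b. m_type_branch P a s u0 t u < m_type_branch P b s u0 t u) w"
        "sorted_wrt (\<lambda>a b. m_type_branch P a s u0 t u' < m_type_branch P b s u0 t u') w'"
    have "t = t0"
      using t multiple by simp
    note w = w[unfolded this letters]
    show "braid_eq n k w w'"
      using sorted[THEN sorted_wrt_key_distinct] w far sub
      by (intro braid_eq_far_permutation) (auto simp: Int_commute)
  qed (use that in blast)
qed


section \<open>Invariance along an admissible deformation\<close>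

lemma type_stable_braid_eq:
  assumes "admissible_deformation n k S \<D> P s" "k_good n k S P" "0 < k"
    and "type_stable n k S \<D> P (s u0)" "u0 \<in> {0..1}"
  obtains V where "open V" "u0 \<in> V"
    "\<And>u u'. u \<in> V \<inter> {0..1} \<Longrightarrow> u' \<in> V \<inter> {0..1} \<Longrightarrow> pleasant n k P (s u) \<Longrightarrow> pleasant n k P (s u') \<Longrightarrow>
       braid_eq n k (system_type n k P (s u)) (system_type n k P (s u'))"
proof -
  have path: "pathin (family_space n S \<D>) s"
    using assms(1) by (simp add: admissible_deformation_def deformation_def)
  consider "pleasant n k P (s u0)" | "simplex_event n k P s u0" | "far_event n k P s u0"
    using assms(1,5) unfolding admissible_deformation_def by metis
  then show thesis
  proof cases
    case 1
    then have "multiple_moments n k P (s u0) = {}"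
      by (auto simp: multiple_moments_def pleasant_def)
    show thesis
      by (rule braid_eq_near_type_stable[OF path assms(4,5) eventually_True])
         (use \<open>multiple_moments n k P (s u0) = {}\<close> that in \<open>blast+\<close>)
  next
    case 2
    from simplex_event_braid_eq[OF assms(2,3) path assms(4,5) this] that show thesis
      by metis
  next
    case 3
    from far_event_braid_eq[OF path assms(4,5) this] that show thesis
      by metis
  qed
qed

lemma braid_eq_on_stable_interval:
  assumes "admissible_deformation n k S \<D> P s" "k_good n k S P" "0 < k"
    and "connected I" "I \<subseteq> {0..1}" "\<And>u. u \<in> I \<Longrightarrow> stable_system n k S \<D> P (s u)"
    and "a \<in> I" "b \<in> I"
  shows "braid_eq n k (system_type n k P (s a)) (system_type n k P (s b))"
proof (rule connected_equivalence_relation_gen[OF assms(4,7,8), where P = "\<lambda>_. True"])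
  fix u assume u: "u \<in> I"
  obtain V where V: "open V" "u \<in> V"
    "\<And>v w. v \<in> V \<inter> {0..1} \<Longrightarrow> w \<in> V \<inter> {0..1} \<Longrightarrow> pleasant n k P (s v) \<Longrightarrow> pleasant n k P (s w) \<Longrightarrow>
       braid_eq n k (system_type n k P (s v)) (system_type n k P (s w))"
    using type_stable_braid_eq[OF assms(1-3), of u] stable_system_imp_type_stable[OF assms(6)] u assms(5)
    by blast
  show "\<exists>T. openin (top_of_set I) T \<and> u \<in> T \<and> (\<forall>v\<in>T. \<forall>w\<in>T. True \<and> True \<longrightarrow>
      braid_eq n k (system_type n k P (s v)) (system_type n k P (s w)))"
  proof (intro exI conjI ballI impI)
    show "openin (top_of_set I) (I \<inter> V)" "u \<in> I \<inter> V"
      using V(1,2) u by auto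
    show "braid_eq n k (system_type n k P (s v)) (system_type n k P (s w))"
      if "v \<in> I \<inter> V" "w \<in> I \<inter> V" for v w
    proof (rule V(3))
      show "pleasant n k P (s v)" "pleasant n k P (s w)"
        using that by (auto intro: stable_system_imp_pleasant[OF assms(6)])
    qed (use that assms(5) in auto)
  qed
next
  show "braid_eq n k (system_type n k P (s x)) (system_type n k P (s z))"
    if "braid_eq n k (system_type n k P (s x)) (system_type n k P (s y))"
      "braid_eq n k (system_type n k P (s y)) (system_type n k P (s z))" for x y z
    using braid_eq_trans[OF that] .
qed auto

text \<open>
  The event compares only the parameters \<open>u0 - \<delta>\<close> and \<open>u0 + \<delta>\<close>. As the punctured neighbourhood is
  stable, the braid is constant on each of its halves, and a single \<open>\<delta>\<close> connects the two.
\<close>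

lemma cancellation_braid_eq:
  assumes adm: "admissible_deformation n k S \<D> P s" "k_good n k S P" "0 < k"
    and event: "cancellation_event n k S \<D> P s u0"
  obtains V where "open V" "u0 \<in> V"
    "\<And>u u'. u \<in> V - {u0} \<Longrightarrow> u' \<in> V - {u0} \<Longrightarrow>
       braid_eq n k (system_type n k P (s u)) (system_type n k P (s u'))"
proof -
  obtain p \<mu> \<epsilon> where \<mu>: "\<mu> \<in> multiindices n k" and \<epsilon>: "0 < \<epsilon>" "{u0-\<epsilon><..<u0+\<epsilon>} \<subseteq> {0..1}"
    and stable: "\<And>u. u \<in> {u0-\<epsilon><..<u0} \<union> {u0<..<u0+\<epsilon>} \<Longrightarrow> stable_system n k S \<D> P (s u)"
    and pair: "\<And>\<delta>. 0 < \<delta> \<Longrightarrow> \<delta> < \<epsilon> \<Longrightarrow>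
      pair_inserted p \<mu> (system_type n k P (s (u0 - \<delta>))) (system_type n k P (s (u0 + \<delta>))) \<or>
      pair_inserted p \<mu> (system_type n k P (s (u0 + \<delta>))) (system_type n k P (s (u0 - \<delta>)))"
    using event unfolding cancellation_event_def Let_def by blast
  let ?eq = "\<lambda>u u'. braid_eq n k (system_type n k P (s u)) (system_type n k P (s u'))"
  have left: "?eq u u'" if "u \<in> {u0-\<epsilon><..<u0}" "u' \<in> {u0-\<epsilon><..<u0}" for u u'
    using that \<epsilon>(2) stable
    by (intro braid_eq_on_stable_interval[OF adm, of "{u0-\<epsilon><..<u0}"]) auto
  have right: "?eq u u'" if "u \<in> {u0<..<u0+\<epsilon>}" "u' \<in> {u0<..<u0+\<epsilon>}" for u u'
    using that \<epsilon>(2) stable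
    by (intro braid_eq_on_stable_interval[OF adm, of "{u0<..<u0+\<epsilon>}"]) auto
  have across: "?eq (u0 - \<epsilon>/2) (u0 + \<epsilon>/2)"
  proof -
    have "stable_system n k S \<D> P (s (u0 - \<epsilon>/2))" "stable_system n k S \<D> P (s (u0 + \<epsilon>/2))"
      using \<epsilon>(1) by (auto intro!: stable)
    then have "set (system_type n k P (s (u0 - \<epsilon>/2))) \<subseteq> multiindices n k"
      "set (system_type n k P (s (u0 + \<epsilon>/2))) \<subseteq> multiindices n k"
      by (auto dest!: stable_system_imp_pleasant set_system_type)
    then show ?thesis
      using pair[of "\<epsilon>/2"] \<epsilon>(1) \<mu> braid_eq_pair_inserted braid_eq_sym
      by (metis field_sum_of_halves half_gt_zero less_add_same_cancel1)
  qed
  have cross: "?eq u u'" if "u \<in> {u0-\<epsilon><..<u0}" "u' \<in> {u0<..<u0+\<epsilon>}" for u u'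
  proof -
    have "?eq u (u0 - \<epsilon>/2)"
      using that(1) \<epsilon>(1) by (intro left) auto
    moreover have "?eq (u0 + \<epsilon>/2) u'"
      using that(2) \<epsilon>(1) by (intro right) auto
    ultimately show ?thesis
      using across by (blast intro: braid_eq_trans)
  qed
  show thesis
  proof (rule that[of "{u0-\<epsilon><..<u0+\<epsilon>}"])
    fix u u' assume "u \<in> {u0-\<epsilon><..<u0+\<epsilon>} - {u0}" "u' \<in> {u0-\<epsilon><..<u0+\<epsilon>} - {u0}"
    then have "u \<in> {u0-\<epsilon><..<u0} \<or> u \<in> {u0<..<u0+\<epsilon>}" "u' \<in> {u0-\<epsilon><..<u0} \<or> u' \<in> {u0<..<u0+\<epsilon>}"
      by auto
    then show "?eq u u'"
      using left right cross braid_eq_sym[OF cross] by blast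
  qed (use \<epsilon>(1) in auto)
qed

lemma admissible_deformation_braid_eq:
  assumes adm: "admissible_deformation n k S \<D> P s" "k_good n k S P" "0 < k"
  shows "braid_eq n k (system_type n k P (s 0)) (system_type n k P (s 1))"
proof (rule connected_equivalence_relation_gen[where S = "{0..1}" and P = "\<lambda>u. stable_system n k S \<D> P (s u)"])
  show "stable_system n k S \<D> P (s 0)" "stable_system n k S \<D> P (s 1)"
    using adm(1) by (simp_all add: admissible_deformation_def deformation_def)
  show "\<exists>z. z \<in> T \<and> stable_system n k S \<D> P (s z)"
    if T: "openin (top_of_set {0..1}) T" "u \<in> T" for T u
  proof -
    have "infinite T"
    proof -
      obtain V where V: "open V" "T = V \<inter> {0..1}"
        using T(1) by (auto simp: openin_open)
      moreover have "u islimpt {0..1}"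
        using T(2) V(2) by (simp add: islimpt_Icc)
      ultimately show ?thesis
        using T(2) unfolding islimpt_eq_acc_point by blast
    qed
    moreover have "finite {u \<in> {0..1}. \<not> pleasant n k P (s u) \<or> \<not> stable_system n k S \<D> P (s u)}"
      using adm(1) by (simp add: admissible_deformation_def)
    ultimately obtain z where "z \<in> T"
      "z \<notin> {u \<in> {0..1}. \<not> pleasant n k P (s u) \<or> \<not> stable_system n k S \<D> P (s u)}"
      by (meson finite_subset subsetI)
    then show ?thesis
      using openin_imp_subset[OF T(1)] by auto
  qed
  fix u0 :: real assume u0: "u0 \<in> {0..1}"
  obtain V where V: "open V" "u0 \<in> V"
    "\<And>u u'. u \<in> V \<inter> {0..1} \<Longrightarrow> u' \<in> V \<inter> {0..1} \<Longrightarrow>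
       stable_system n k S \<D> P (s u) \<Longrightarrow> stable_system n k S \<D> P (s u') \<Longrightarrow>
       braid_eq n k (system_type n k P (s u)) (system_type n k P (s u'))"
  proof (cases "type_stable n k S \<D> P (s u0)")
    case True
    from type_stable_braid_eq[OF adm this u0] that show thesis
      using stable_system_imp_pleasant by metis
  next
    case False
    then have "cancellation_event n k S \<D> P s u0"
      using adm(1) u0 by (simp add: admissible_deformation_def)
    from cancellation_braid_eq[OF adm this] obtain V where V: "open V" "u0 \<in> V"
      "\<And>u u'. u \<in> V - {u0} \<Longrightarrow> u' \<in> V - {u0} \<Longrightarrow>
         braid_eq n k (system_type n k P (s u)) (system_type n k P (s u'))"
      by metis
    show thesis
    proof (rule that[OF V(1,2)])
      fix u u' assume "u \<in> V \<inter> {0..1}" "u' \<in> V \<inter> {0..1}"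
        and "stable_system n k S \<D> P (s u)" "stable_system n k S \<D> P (s u')"
      moreover from this have "u \<noteq> u0" "u' \<noteq> u0"
        using False stable_system_imp_type_stable by blast+
      ultimately show "braid_eq n k (system_type n k P (s u)) (system_type n k P (s u'))"
        by (intro V(3)) auto
    qed
  qed
  then show "\<exists>T. openin (top_of_set {0..1}) T \<and> u0 \<in> T \<and> (\<forall>u\<in>T. \<forall>u'\<in>T.
      stable_system n k S \<D> P (s u) \<and> stable_system n k S \<D> P (s u') \<longrightarrow>
      braid_eq n k (system_type n k P (s u)) (system_type n k P (s u')))"
    using u0 by (intro exI[of _ "{0..1} \<inter> V"]) auto
next
  show "braid_eq n k (system_type n k P (s x)) (system_type n k P (s z))"
    if "braid_eq n k (system_type n k P (s x)) (system_type n k P (s y))"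
      "braid_eq n k (system_type n k P (s y)) (system_type n k P (s z))" for x y z
    using braid_eq_trans[OF that] .
qed auto

theorem theorem2:
  fixes n k :: nat and S :: "'a topology" and \<D> :: "'a system set" and P :: "'a property"
    and D0 D1 :: "'a system"
  assumes "0 < k" and "k < n"
    and "admissible_systems n S \<D>"
    and "k_correct n k S \<D> P"
    and "D0 \<in> \<D>" and "D1 \<in> \<D>"
    and "equivalent_systems n k S \<D> P D0 D1"
    and "pleasant n k P D0" and "stable_system n k S \<D> P D0"
    and "pleasant n k P D1" and "stable_system n k S \<D> P D1"
  shows "braid_of_system n k P D0 = braid_of_system n k P D1"
proof -
  obtain s where "deformation n k S \<D> P s" "s 0 = D0" "s 1 = D1"
    using assms(7) by (auto simp: equivalent_systems_def)
  then obtain s' where s': "admissible_deformation n k S \<D> P s'" "s' 0 = D0" "s' 1 = D1"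
    using assms(4) unfolding k_correct_def by metis
  have "k_good n k S P"
    using assms(4) by (simp add: k_correct_def)
  from admissible_deformation_braid_eq[OF s'(1) this assms(1)] show ?thesis
    unfolding s' using assms(8,10) by (intro braid_of_system_eqI)
qed

end
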